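(* Let $S=\bigoplus_{n=0}^\infty S_n$ be a graded ring, and let $I$ be a graded left ideal of $S$. Then $\sqrt[\mathrm{j}]{I}$ is graded, and furthermore, $S_n\cap\sqrt[\mathrm{j}]{I}$ is integral over $I$ for all $n\ge1$.
   Context: Rings are associative and unital, not necessarily commutative. A left ideal $I$ of $S$ is graded if $I=\bigoplus_{n\ge0}(I\cap S_n)$. The Jacobson radical $\sqrt[\mathrm{j}]{I}$ of a left ideal $I$ of $S$ is the intersection of all maximal left ideals of $S$ containing $I$ (so it is $S$ when $I=S$). An element $a\in S$ is integral over a left ideal $I$ of $S$ if there exist $m\ge1$ and $r_0,\dots,r_{m-1}\in I$ with $a^m+r_{m-1}a^{m-1}+\cdots+r_1a+r_0=0$; a subset of $S$ is integral over $I$ if each of its elements is. *)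

theory Defs
  imports "HOL-Algebra.Ideal"
begin

locale left_ideal = additive_subgroup I R + ring R for I and R (structure) +
  assumes left_closed: "\<lbrakk>a \<in> I; x \<in> carrier R\<rbrakk> \<Longrightarrow> x \<otimes> a \<in> I"

text \<open>The one-sided counterpart of \<^locale>\<open>maximalideal\<close>.\<close>

locale maximal_left_ideal = left_ideal +
  assumes proper: "carrier R \<noteq> I"
    and maximal: "\<lbrakk>left_ideal J R; I \<subseteq> J; J \<subseteq> carrier R\<rbrakk> \<Longrightarrow> J = I \<or> J = carrier R"

text \<open>The intersection with the carrier makes the radical of \<^term>\<open>carrier R\<close>,
  which no maximal left ideal contains, equal to \<^term>\<open>carrier R\<close>.\<close>

definition jacobson_radical :: "('a, 'b) ring_scheme \<Rightarrow> 'a set \<Rightarrow> 'a set" where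
  "jacobson_radical R I = carrier R \<inter> \<Inter>{M. maximal_left_ideal M R \<and> I \<subseteq> M}"

text \<open>\<^term>\<open>M\<close> is the internal direct sum of the additive subgroups \<^term>\<open>A n\<close>:
  every element of \<^term>\<open>M\<close> is in a unique way a sum of a finitely supported family
  of components.\<close>

definition internal_direct_sum ::
  "('a, 'b) ring_scheme \<Rightarrow> 'a set \<Rightarrow> (nat \<Rightarrow> 'a set) \<Rightarrow> bool" where
  "internal_direct_sum R M A \<longleftrightarrow>
     additive_subgroup M R \<and>
     (\<forall>n. additive_subgroup (A n) R \<and> A n \<subseteq> M) \<and>
     (\<forall>x\<in>M. \<exists>!f. (\<forall>n. f n \<in> A n) \<and> finite {n. f n \<noteq> \<zero>\<^bsub>R\<^esub>} \<and>
        x = (\<Oplus>\<^bsub>R\<^esub>n\<in>{n. f n \<noteq> \<zero>\<^bsub>R\<^esub>}. f n))"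

locale graded_ring = ring R for R (structure) and A :: "nat \<Rightarrow> 'a set" +
  assumes direct_sum: "internal_direct_sum R (carrier R) A"
    and graded_mult: "\<lbrakk>x \<in> A m; y \<in> A n\<rbrakk> \<Longrightarrow> x \<otimes> y \<in> A (m + n)"

definition graded_left_ideal ::
  "('a, 'b) ring_scheme \<Rightarrow> (nat \<Rightarrow> 'a set) \<Rightarrow> 'a set \<Rightarrow> bool" where
  "graded_left_ideal R A I \<longleftrightarrow>
     left_ideal I R \<and> internal_direct_sum R I (\<lambda>n. I \<inter> A n)"

definition integral_element :: "('a, 'b) ring_scheme \<Rightarrow> 'a set \<Rightarrow> 'a \<Rightarrow> bool" where
  "integral_element R I a \<longleftrightarrow>
     a \<in> carrier R \<and>
     (\<exists>m\<ge>1::nat. \<exists>r :: nat \<Rightarrow> 'a. (\<forall>i<m. r i \<in> I) \<and>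
        a [^]\<^bsub>R\<^esub> m \<oplus>\<^bsub>R\<^esub> (\<Oplus>\<^bsub>R\<^esub>i\<in>{..<m}. r i \<otimes>\<^bsub>R\<^esub> a [^]\<^bsub>R\<^esub> i) = \<zero>\<^bsub>R\<^esub>)"

definition integral_subset :: "('a, 'b) ring_scheme \<Rightarrow> 'a set \<Rightarrow> 'a set \<Rightarrow> bool" where
  "integral_subset R I X \<longleftrightarrow> (\<forall>a\<in>X. integral_element R I a)"

end

theory Submission
  imports Defs
begin

text \<open>
  Write \<open>N\<close> for the Jacobson radical of the graded left ideal \<open>I\<close>. The one property of \<open>N\<close> that is
  used is a form of Nakayama's lemma: a left ideal that contains \<open>I\<close> and some \<open>\<one> \<ominus> c\<close> with
  \<open>c \<in> N\<close> is the whole ring, for otherwise it lies in a maximal left ideal, which contains \<open>c\<close>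
  as well (\<open>one_mem_if_one_minus_radical_mem\<close>).

  Integrality. If \<open>a \<in> N\<close> is homogeneous of degree \<open>n \<ge> 1\<close>, then \<open>\<one> = b \<otimes> (\<one> \<ominus> a) \<oplus> v\<close> with
  \<open>v \<in> I\<close>. Comparing components, \<open>b\<^sub>0\<close> is \<open>\<one>\<close> and \<open>b\<close> in degree \<open>k + n\<close> is \<open>b\<^sub>k \<otimes> a\<close>, up to
  components of \<open>v\<close>, which lie in \<open>I\<close>. So \<open>b\<close> imitates the geometric series of \<open>a\<close>, and since it
  has only finitely many components, following the degrees \<open>0, n, 2n, \<dots>\<close> until the component of
  \<open>b\<close> vanishes gives an equation of integral dependence (\<open>integral_if_radical\<close>).

  Gradedness. The argument is Bergman's for the radical of a graded ring, with the group ring of a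
  cyclic group in the place of roots of unity. Let \<open>M\<close> be a maximal left ideal containing \<open>I\<close> and
  \<open>V\<close> the simple module \<open>R/M\<close>. For \<open>n \<ge> 1\<close> let \<open>W\<close> be the module of \<open>n\<close>-periodic functions from
  \<open>\<int>\<close> to \<open>V\<close>, on which an element \<open>s\<close> of degree \<open>i\<close> acts by \<open>(s w)(k) = s w(k - i)\<close>. Applying
  \<open>x \<in> R\<close> to the function that is \<open>1\<close> on the multiples of \<open>n\<close> and \<open>0\<close> elsewhere lists the
  components of \<open>x\<close>, summed over each residue class modulo \<open>n\<close>. As \<open>I\<close> is graded and contained in
  \<open>M\<close>, it kills this function. Let \<open>U\<close> be the submodule of \<open>W\<close> that \<open>N\<close> generates from it and
  its translates. Two facts about \<open>U\<close> are played against each other.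

  \<^item> Nakayama: a submodule \<open>X\<close> with \<open>X + U = W\<close> is \<open>W\<close> (\<open>nakayama\<close>).

  \<^item> Maschke: \<open>U\<close> is invariant under translation, hence also under the action on values without
  translation. For the latter \<open>W\<close> is a finite power of a simple module, so there is a linear
  projection onto \<open>U\<close>. Averaging it over translations gives a map \<open>q\<close> from \<open>W\<close> to \<open>U\<close> that is
  linear for the original action and equals \<open>n\<close> on \<open>U\<close> (\<open>averaged_projection\<close>).

  If \<open>n\<close> is invertible on \<open>V\<close>, then \<open>ker q + U = W\<close>, so \<open>q = 0\<close> and \<open>n U = 0\<close>. If \<open>n\<close> is not
  invertible on \<open>V\<close>, it kills \<open>V\<close>, and again \<open>n U = 0\<close>. For \<open>x \<in> N\<close> and \<open>n\<close> beyond all degrees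
  of \<open>x\<close> this says that \<open>n\<close> times each component of \<open>x\<close> lies in \<open>M\<close>. Subtracting this for \<open>n\<close>
  from the same for \<open>n + 1\<close> puts the components themselves into \<open>M\<close>, for every \<open>M\<close>.
\<close>

section \<open>Left ideals and maximal left ideals\<close>

context ring
begin

lemma left_idealI':
  assumes "L \<subseteq> carrier R" "\<zero> \<in> L"
    and add: "\<And>x y. x \<in> L \<Longrightarrow> y \<in> L \<Longrightarrow> x \<oplus> y \<in> L"
    and mult: "\<And>r x. r \<in> carrier R \<Longrightarrow> x \<in> L \<Longrightarrow> r \<otimes> x \<in> L"
  shows "left_ideal L R"
proof -
  have neg: "\<ominus> x \<in> L" if "x \<in> L" for x
  proof -
    have "\<ominus> x = (\<ominus> \<one>) \<otimes> x" using that assms(1) by (auto simp: l_minus)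
    then show ?thesis using mult[of "\<ominus> \<one>" x] that by simp
  qed
  have "additive_subgroup L R"
    by (intro additive_subgroupI add.subgroupI) (use assms neg in auto)
  then show ?thesis
    by (intro left_ideal.intro left_ideal_axioms.intro) (auto intro: mult ring_axioms)
qed

lemma left_idealD:
  assumes "left_ideal L R"
  shows "L \<subseteq> carrier R" "\<zero> \<in> L"
    and "\<And>x y. x \<in> L \<Longrightarrow> y \<in> L \<Longrightarrow> x \<oplus> y \<in> L"
    and "\<And>x y. x \<in> L \<Longrightarrow> y \<in> L \<Longrightarrow> x \<ominus> y \<in> L"
    and "\<And>r x. r \<in> carrier R \<Longrightarrow> x \<in> L \<Longrightarrow> r \<otimes> x \<in> L"
proof -
  interpret left_ideal L R by fact
  show "L \<subseteq> carrier R" "\<zero> \<in> L" using a_subset zero_closed by auto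
  show "\<And>x y. x \<in> L \<Longrightarrow> y \<in> L \<Longrightarrow> x \<oplus> y \<in> L" by (rule a_closed)
  show "\<And>x y. x \<in> L \<Longrightarrow> y \<in> L \<Longrightarrow> x \<ominus> y \<in> L"
    by (simp add: a_minus_def)
  show "\<And>r x. r \<in> carrier R \<Longrightarrow> x \<in> L \<Longrightarrow> r \<otimes> x \<in> L" by (rule left_closed)
qed

lemma left_ideal_eq_carrier:
  assumes "left_ideal L R" "\<one> \<in> L"
  shows "L = carrier R"
  using left_idealD(1,5)[OF assms(1)] assms(2) by (force dest: r_one)

lemma left_ideal_Union_chain:
  assumes "\<C> \<noteq> {}" "\<And>L. L \<in> \<C> \<Longrightarrow> left_ideal L R"
    and chain: "\<And>K L. K \<in> \<C> \<Longrightarrow> L \<in> \<C> \<Longrightarrow> K \<subseteq> L \<or> L \<subseteq> K"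
  shows "left_ideal (\<Union>\<C>) R"
proof (rule left_idealI')
  note D = left_idealD[OF assms(2)]
  show "\<Union>\<C> \<subseteq> carrier R" using D(1) by blast
  show "\<zero> \<in> \<Union>\<C>" using D(2) assms(1) by blast
  show "r \<otimes> x \<in> \<Union>\<C>" if "r \<in> carrier R" "x \<in> \<Union>\<C>" for r x using D(5) that by blast
  show "x \<oplus> y \<in> \<Union>\<C>" if xy: "x \<in> \<Union>\<C>" "y \<in> \<Union>\<C>" for x y
  proof -
    from xy obtain K L where "K \<in> \<C>" "L \<in> \<C>" "x \<in> K" "y \<in> L" by blast
    with chain[of K L] D(3)[of K x y] D(3)[of L x y] show ?thesis by blast
  qed
qed

lemma exists_maximal_left_ideal:
  assumes L: "left_ideal L R" and "\<one> \<notin> L"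
  shows "\<exists>M. maximal_left_ideal M R \<and> L \<subseteq> M"
proof -
  let ?F = "{K. left_ideal K R \<and> L \<subseteq> K \<and> \<one> \<notin> K}"
  have "\<exists>M\<in>?F. \<forall>X\<in>?F. M \<subseteq> X \<longrightarrow> X = M"
  proof (rule subset_Zorn_nonempty)
    show "?F \<noteq> {}" using assms by blast
    show "\<Union>\<C> \<in> ?F" if ne: "\<C> \<noteq> {}" and ch: "subset.chain ?F \<C>" for \<C>
    proof -
      have C: "\<C> \<subseteq> ?F" and lin: "\<And>K L. K \<in> \<C> \<Longrightarrow> L \<in> \<C> \<Longrightarrow> K \<subseteq> L \<or> L \<subseteq> K"
        using ch by (auto simp: subset_chain_def)
      have "left_ideal (\<Union>\<C>) R"
        by (rule left_ideal_Union_chain) (use ne C lin in auto)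
      then show ?thesis using ne C by blast
    qed
  qed
  then obtain M where M: "left_ideal M R" "L \<subseteq> M" "\<one> \<notin> M"
    and max: "\<And>X. left_ideal X R \<Longrightarrow> \<one> \<notin> X \<Longrightarrow> M \<subseteq> X \<Longrightarrow> X = M"
    by (smt (verit) mem_Collect_eq order_trans)
  have "maximal_left_ideal M R"
  proof (intro maximal_left_ideal.intro maximal_left_ideal_axioms.intro M(1))
    show "carrier R \<noteq> M" using M(3) by auto
    show "J = M \<or> J = carrier R" if "left_ideal J R" "M \<subseteq> J" for J
      using max[OF that(1) _ that(2)] left_ideal_eq_carrier[OF that(1)] by blast
  qed
  with M show ?thesis by blast
qed

lemma maximal_left_idealD:
  assumes "maximal_left_ideal M R"
  shows "left_ideal M R" "\<one> \<notin> M"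
    and "\<And>L. left_ideal L R \<Longrightarrow> M \<subseteq> L \<Longrightarrow> \<one> \<notin> L \<Longrightarrow> L = M"
proof -
  interpret maximal_left_ideal M R by fact
  show M: "left_ideal M R" by (rule left_ideal_axioms)
  show "\<one> \<notin> M" using left_ideal_eq_carrier[OF M] proper by blast
  show "L = M" if "left_ideal L R" "M \<subseteq> L" "\<one> \<notin> L" for L
    using maximal[of L] that left_idealD(1) by fastforce
qed

lemma left_ideal_add:
  assumes K: "left_ideal K R" and L: "left_ideal L R"
  shows "left_ideal {x \<oplus> y | x y. x \<in> K \<and> y \<in> L} R"
proof (rule left_idealI')
  note K = left_idealD[OF K] and L = left_idealD[OF L]
  show "{x \<oplus> y | x y. x \<in> K \<and> y \<in> L} \<subseteq> carrier R" using K(1) L(1) by auto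
  show "\<zero> \<in> {x \<oplus> y | x y. x \<in> K \<and> y \<in> L}" using K(2) L(2) l_zero by force
  fix u assume "u \<in> {x \<oplus> y | x y. x \<in> K \<and> y \<in> L}"
  then obtain x y where u: "u = x \<oplus> y" "x \<in> K" "y \<in> L" by blast
  then have xy: "x \<in> carrier R" "y \<in> carrier R" using K(1) L(1) by auto
  show "r \<otimes> u \<in> {x \<oplus> y | x y. x \<in> K \<and> y \<in> L}" if r: "r \<in> carrier R" for r
  proof -
    have "r \<otimes> u = r \<otimes> x \<oplus> r \<otimes> y" using u xy r by (simp add: r_distr)
    then show ?thesis using K(5)[OF r u(2)] L(5)[OF r u(3)] by blast
  qed
  show "u \<oplus> v \<in> {x \<oplus> y | x y. x \<in> K \<and> y \<in> L}"
    if v: "v \<in> {x \<oplus> y | x y. x \<in> K \<and> y \<in> L}" for v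
  proof -
    from v obtain x' y' where v: "v = x' \<oplus> y'" "x' \<in> K" "y' \<in> L" by blast
    then have xy': "x' \<in> carrier R" "y' \<in> carrier R" using K(1) L(1) by auto
    have "u \<oplus> v = (x \<oplus> x') \<oplus> (y \<oplus> y')" using u v xy xy' by (simp add: a_ac)
    then show ?thesis using K(3)[OF u(2) v(2)] L(3)[OF u(3) v(3)] by blast
  qed
qed

lemma left_ideal_principal:
  assumes a: "a \<in> carrier R"
  shows "left_ideal {r \<otimes> a | r. r \<in> carrier R} R"
proof (rule left_idealI')
  show "{r \<otimes> a | r. r \<in> carrier R} \<subseteq> carrier R" using a by auto
  show "\<zero> \<in> {r \<otimes> a | r. r \<in> carrier R}" using l_null[OF a] by force
  show "x \<oplus> y \<in> {r \<otimes> a | r. r \<in> carrier R}"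
    if "x \<in> {r \<otimes> a | r. r \<in> carrier R}" "y \<in> {r \<otimes> a | r. r \<in> carrier R}" for x y
    using that a by (force simp: l_distr[symmetric])
  show "s \<otimes> x \<in> {r \<otimes> a | r. r \<in> carrier R}"
    if "s \<in> carrier R" "x \<in> {r \<otimes> a | r. r \<in> carrier R}" for s x
    using that a by (force simp: m_assoc[symmetric])
qed

lemma left_inverse_mod_maximal:
  assumes M: "maximal_left_ideal M R" and x: "x \<in> carrier R" "x \<notin> M"
  shows "\<exists>r\<in>carrier R. \<one> \<ominus> r \<otimes> x \<in> M"
proof -
  note MD = maximal_left_idealD[OF M] and L = left_idealD[OF maximal_left_idealD(1)[OF M]]
  let ?K = "{u \<oplus> v | u v. u \<in> {r \<otimes> x | r. r \<in> carrier R} \<and> v \<in> M}"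
  have K: "left_ideal ?K R" using left_ideal_add left_ideal_principal x(1) MD(1) by blast
  have "m \<in> ?K" if m: "m \<in> M" for m
  proof -
    have "m = \<zero> \<otimes> x \<oplus> m" using x m L(1) by auto
    then show ?thesis using m by blast
  qed
  moreover have "x \<in> ?K"
  proof -
    have "x = \<one> \<otimes> x \<oplus> \<zero>" using x by auto
    then show ?thesis using L(2) by blast
  qed
  ultimately have "\<one> \<in> ?K" using MD(3)[OF K] x(2) by blast
  then obtain r m where r: "r \<in> carrier R" "m \<in> M" "\<one> = r \<otimes> x \<oplus> m" by blast
  then have m: "m \<in> carrier R" using L(1) by auto
  have "(r \<otimes> x \<oplus> m) \<ominus> r \<otimes> x = m" using r(1) x(1) m by algebra
  then have "\<one> \<ominus> r \<otimes> x \<in> M" using r(2,3) by simp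
  with r(1) show ?thesis by blast
qed

lemma jacobson_radicalD:
  assumes "x \<in> jacobson_radical R I"
  shows "x \<in> carrier R" "\<And>M. maximal_left_ideal M R \<Longrightarrow> I \<subseteq> M \<Longrightarrow> x \<in> M"
  using assms by (auto simp: jacobson_radical_def)

lemma jacobson_radical_left_ideal: "left_ideal (jacobson_radical R I) R"
  by (rule left_idealI')
    (auto simp: jacobson_radical_def dest: maximal_left_idealD(1) intro: left_idealD(2,3,5))

text \<open>Nakayama's lemma in the form in which the radical is used throughout.\<close>

lemma one_mem_if_one_minus_radical_mem:
  assumes L: "left_ideal L R" "I \<subseteq> L"
    and c: "c \<in> jacobson_radical R I" "\<one> \<ominus> c \<in> L"
  shows "\<one> \<in> L"
proof (rule ccontr)
  assume "\<one> \<notin> L"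
  then obtain M where M: "maximal_left_ideal M R" "L \<subseteq> M"
    using exists_maximal_left_ideal[OF L(1)] by blast
  note D = left_idealD[OF maximal_left_idealD(1)[OF M(1)]]
  have cM: "c \<in> M" and cc: "c \<in> carrier R" using jacobson_radicalD[OF c(1)] M L(2) by auto
  have "(\<one> \<ominus> c) \<oplus> c \<in> M" using D(3) M(2) c(2) cM by blast
  moreover have "(\<one> \<ominus> c) \<oplus> c = \<one>" using cc by algebra
  ultimately show False using maximal_left_idealD(2)[OF M(1)] by simp
qed

end

lemma (in ring) left_ideal_finsum:
  assumes L: "left_ideal L R" and f: "\<And>i. i \<in> D \<Longrightarrow> f i \<in> L"
  shows "(\<Oplus>i\<in>D. f i) \<in> L"
proof (cases "finite D")
  case True
  then show ?thesis using f
  proof (induction D rule: finite_induct)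
    case empty
    then show ?case using left_idealD(2)[OF L] by simp
  next
    case (insert i D)
    have "f \<in> D \<rightarrow> carrier R" "f i \<in> carrier R" using insert.prems left_idealD(1)[OF L] by auto
    then have "(\<Oplus>j\<in>insert i D. f j) = f i \<oplus> (\<Oplus>j\<in>D. f j)"
      using insert.hyps by (simp add: finsum_insert)
    then show ?case using insert left_idealD(3)[OF L] by simp
  qed
next
  case False
  then show ?thesis using left_idealD(2)[OF L] by (simp add: finsum_infinite)
qed

section \<open>Homogeneous components\<close>

context graded_ring
begin

definition component :: "'a \<Rightarrow> nat \<Rightarrow> 'a" where
  "component x = (THE f. (\<forall>n. f n \<in> A n) \<and> finite {n. f n \<noteq> \<zero>} \<and>
     x = (\<Oplus>n\<in>{n. f n \<noteq> \<zero>}. f n))"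

lemma degree_subgroup: "additive_subgroup (A n) R" and degree_subset: "A n \<subseteq> carrier R"
  using direct_sum by (auto simp: internal_direct_sum_def)

lemma degree_closed [simp]: "x \<in> A n \<Longrightarrow> x \<in> carrier R"
  using degree_subset by blast

lemma degree_zero [simp]: "\<zero> \<in> A n"
  using additive_subgroup.zero_closed[OF degree_subgroup] .

lemma degree_add: "x \<in> A n \<Longrightarrow> y \<in> A n \<Longrightarrow> x \<oplus> y \<in> A n"
  using additive_subgroup.a_closed[OF degree_subgroup] .

lemma component_props:
  assumes "x \<in> carrier R"
  shows "component x n \<in> A n" "finite {n. component x n \<noteq> \<zero>}"
    and "x = (\<Oplus>n\<in>{n. component x n \<noteq> \<zero>}. component x n)"
proof -
  have "\<exists>!f. (\<forall>n. f n \<in> A n) \<and> finite {n. f n \<noteq> \<zero>} \<and> x = (\<Oplus>n\<in>{n. f n \<noteq> \<zero>}. f n)"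
    using direct_sum assms by (auto simp: internal_direct_sum_def)
  from theI'[OF this, folded component_def]
  show "component x n \<in> A n" "finite {n. component x n \<noteq> \<zero>}"
    "x = (\<Oplus>n\<in>{n. component x n \<noteq> \<zero>}. component x n)" by blast+
qed

lemma component_closed [simp]: "x \<in> carrier R \<Longrightarrow> component x n \<in> carrier R"
  using component_props(1) degree_closed by blast

lemma component_sum:
  assumes "x \<in> carrier R" "finite D" "\<And>n. n \<notin> D \<Longrightarrow> component x n = \<zero>"
  shows "x = (\<Oplus>n\<in>D. component x n)"
proof -
  have "(\<Oplus>n\<in>{n. component x n \<noteq> \<zero>}. component x n) = (\<Oplus>n\<in>D. component x n)"
    by (rule add.finprod_mono_neutral_cong_left) (use assms in auto)
  then show ?thesis using component_props(3)[OF assms(1)] by simp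
qed

lemma component_eqI:
  assumes f: "\<And>n. f n \<in> A n" and D: "finite D" "\<And>n. n \<notin> D \<Longrightarrow> f n = \<zero>"
    and x: "x = (\<Oplus>n\<in>D. f n)"
  shows "component x = f"
proof -
  have xc: "x \<in> carrier R" unfolding x using degree_closed[OF f] by (auto intro: finsum_closed)
  have sub: "{n. f n \<noteq> \<zero>} \<subseteq> D" using D(2) by blast
  have "(\<Oplus>n\<in>{n. f n \<noteq> \<zero>}. f n) = (\<Oplus>n\<in>D. f n)"
    by (rule add.finprod_mono_neutral_cong_left) (use D sub degree_closed[OF f] in auto)
  then have "(\<forall>n. f n \<in> A n) \<and> finite {n. f n \<noteq> \<zero>} \<and> x = (\<Oplus>n\<in>{n. f n \<noteq> \<zero>}. f n)"
    using f finite_subset[OF sub D(1)] x by simp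
  moreover have "\<exists>!f. (\<forall>n. f n \<in> A n) \<and> finite {n. f n \<noteq> \<zero>} \<and> x = (\<Oplus>n\<in>{n. f n \<noteq> \<zero>}. f n)"
    using direct_sum xc by (auto simp: internal_direct_sum_def)
  ultimately show ?thesis unfolding component_def by (intro the1_equality)
qed

lemma component_homogeneous:
  assumes "x \<in> A m"
  shows "component x n = (if n = m then x else \<zero>)"
proof -
  have "component x = (\<lambda>n. if n = m then x else \<zero>)"
    by (rule component_eqI[where D = "{m}"]) (use assms in auto)
  then show ?thesis by simp
qed

lemma component_add:
  assumes x: "x \<in> carrier R" and y: "y \<in> carrier R"
  shows "component (x \<oplus> y) n = component x n \<oplus> component y n"
proof -
  let ?D = "{n. component x n \<noteq> \<zero>} \<union> {n. component y n \<noteq> \<zero>}"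
  have D: "finite ?D" using component_props(2) x y by simp
  have "x \<oplus> y = (\<Oplus>n\<in>?D. component x n) \<oplus> (\<Oplus>n\<in>?D. component y n)"
    using component_sum[OF x D] component_sum[OF y D] by simp
  also have "\<dots> = (\<Oplus>n\<in>?D. component x n \<oplus> component y n)"
    by (rule finsum_addf[symmetric]) (use x y in auto)
  finally have "component (x \<oplus> y) = (\<lambda>n. component x n \<oplus> component y n)"
    by (intro component_eqI[OF _ D]) (use x y component_props(1) in \<open>auto intro: degree_add\<close>)
  then show ?thesis by simp
qed

lemma component_mult_left:
  assumes r: "r \<in> A m" and x: "x \<in> carrier R"
  shows "component (r \<otimes> x) (m + n) = r \<otimes> component x n"
    and "k < m \<Longrightarrow> component (r \<otimes> x) k = \<zero>"
proof -
  let ?D = "{n. component x n \<noteq> \<zero>}"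
  let ?f = "\<lambda>k. if m \<le> k then r \<otimes> component x (k - m) else \<zero>"
  have "r \<otimes> x = r \<otimes> (\<Oplus>n\<in>?D. component x n)" using component_props(3)[OF x] by simp
  also have "\<dots> = (\<Oplus>n\<in>?D. r \<otimes> component x n)"
    by (rule finsum_rdistr) (use r x component_props(2) in auto)
  also have "\<dots> = (\<Oplus>n\<in>?D. ?f (m + n))"
    by (rule finsum_cong') (use r x in auto)
  also have "\<dots> = (\<Oplus>k\<in>(+) m ` ?D. ?f k)"
    by (rule finsum_reindex[symmetric]) (use r x in auto)
  finally have eq: "r \<otimes> x = (\<Oplus>k\<in>(+) m ` ?D. ?f k)" .
  have "component (r \<otimes> x) = ?f"
  proof (rule component_eqI[OF _ _ _ eq])
    show "?f k \<in> A k" for k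
      using graded_mult[OF r component_props(1)[OF x, of "k - m"]] by auto
    show "finite ((+) m ` ?D)" using component_props(2)[OF x] by simp
    show "?f k = \<zero>" if k: "k \<notin> (+) m ` ?D" for k
    proof (cases "m \<le> k")
      case True
      then have "k = m + (k - m)" by simp
      then have "component x (k - m) = \<zero>" using k by blast
      then show ?thesis using r by simp
    qed simp
  qed
  then show "component (r \<otimes> x) (m + n) = r \<otimes> component x n"
    "k < m \<Longrightarrow> component (r \<otimes> x) k = \<zero>" by simp_all
qed

lemma component_mult_right:
  assumes r: "r \<in> A m" and x: "x \<in> carrier R"
  shows "component (x \<otimes> r) (n + m) = component x n \<otimes> r"
    and "k < m \<Longrightarrow> component (x \<otimes> r) k = \<zero>"
proof -
  let ?D = "{n. component x n \<noteq> \<zero>}"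
  let ?f = "\<lambda>k. if m \<le> k then component x (k - m) \<otimes> r else \<zero>"
  have "x \<otimes> r = (\<Oplus>n\<in>?D. component x n) \<otimes> r" using component_props(3)[OF x] by simp
  also have "\<dots> = (\<Oplus>n\<in>?D. component x n \<otimes> r)"
    by (rule finsum_ldistr) (use r x component_props(2) in auto)
  also have "\<dots> = (\<Oplus>n\<in>?D. ?f (m + n))"
    by (rule finsum_cong') (use r x in auto)
  also have "\<dots> = (\<Oplus>k\<in>(+) m ` ?D. ?f k)"
    by (rule finsum_reindex[symmetric]) (use r x in auto)
  finally have eq: "x \<otimes> r = (\<Oplus>k\<in>(+) m ` ?D. ?f k)" .
  have "component (x \<otimes> r) = ?f"
  proof (rule component_eqI[OF _ _ _ eq])
    show "?f k \<in> A k" for k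
      using graded_mult[OF component_props(1)[OF x, of "k - m"] r] by auto
    show "finite ((+) m ` ?D)" using component_props(2)[OF x] by simp
    show "?f k = \<zero>" if k: "k \<notin> (+) m ` ?D" for k
    proof (cases "m \<le> k")
      case True
      then have "k = m + (k - m)" by simp
      then have "component x (k - m) = \<zero>" using k by blast
      then show ?thesis using r by simp
    qed simp
  qed
  then show "component (x \<otimes> r) (n + m) = component x n \<otimes> r"
    "k < m \<Longrightarrow> component (x \<otimes> r) k = \<zero>" by simp_all
qed

text \<open>The component \<open>e\<close> of degree \<open>0\<close> of \<open>\<one>\<close> fixes every homogeneous element \<open>x\<close> from
  the left, as one sees by comparing \<open>x\<close> with \<open>\<one> \<otimes> x\<close> in the degree of \<open>x\<close>; hence \<open>e = e \<otimes> \<one> = \<one>\<close>.\<close>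

lemma one_degree_zero: "\<one> \<in> A 0"
proof -
  let ?e = "component \<one> 0"
  have fix_hom: "?e \<otimes> x = x" if "x \<in> A m" for x m
    using component_mult_right(1)[OF that one_closed, of 0] that by (simp add: component_homogeneous)
  have "\<one> = (\<Oplus>n\<in>{n. component \<one> n \<noteq> \<zero>}. component \<one> n)"
    using component_props(3) one_closed by blast
  also have "\<dots> = (\<Oplus>n\<in>{n. component \<one> n \<noteq> \<zero>}. ?e \<otimes> component \<one> n)"
    by (rule finsum_cong') (use fix_hom[OF component_props(1)[OF one_closed]] in auto)
  also have "\<dots> = ?e \<otimes> (\<Oplus>n\<in>{n. component \<one> n \<noteq> \<zero>}. component \<one> n)"
    by (rule finsum_rdistr[symmetric]) (use component_props(2) in auto)
  also have "\<dots> = ?e" using component_props(3)[of \<one>] by simp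
  finally show ?thesis using component_props(1)[of \<one> 0] by simp
qed

lemma graded_left_idealD:
  assumes "graded_left_ideal R A I"
  shows "left_ideal I R" "\<And>x n. x \<in> I \<Longrightarrow> component x n \<in> I"
proof -
  show L: "left_ideal I R" using assms by (simp add: graded_left_ideal_def)
  show "component x n \<in> I" if "x \<in> I" for x n
  proof -
    have "\<exists>f. (\<forall>n. f n \<in> I \<inter> A n) \<and> finite {n. f n \<noteq> \<zero>} \<and> x = (\<Oplus>n\<in>{n. f n \<noteq> \<zero>}. f n)"
      using assms that unfolding graded_left_ideal_def internal_direct_sum_def by blast
    then obtain f where f: "\<forall>n. f n \<in> I \<inter> A n" "finite {n. f n \<noteq> \<zero>}"
      "x = (\<Oplus>n\<in>{n. f n \<noteq> \<zero>}. f n)" by blast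
    have "component x = f"
      by (rule component_eqI[OF _ f(2) _ f(3)]) (use f(1) in blast)+
    with f(1) show ?thesis by simp
  qed
qed

lemma graded_left_idealI:
  assumes L: "left_ideal I R" and c: "\<And>x n. x \<in> I \<Longrightarrow> component x n \<in> I"
  shows "graded_left_ideal R A I"
  unfolding graded_left_ideal_def internal_direct_sum_def
proof (intro conjI allI ballI)
  interpret left_ideal I R by fact
  show "left_ideal I R" by fact
  show "additive_subgroup I R" by (rule is_additive_subgroup)
  show "additive_subgroup (I \<inter> A n) R" for n
    using add.subgroups_Inter_pair a_subgroup additive_subgroup.a_subgroup[OF degree_subgroup]
    by (blast intro: additive_subgroupI)
  show "I \<inter> A n \<subseteq> I" for n by blast
  fix x assume x: "x \<in> I"
  then have xc: "x \<in> carrier R" by simp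
  show "\<exists>!f. (\<forall>n. f n \<in> I \<inter> A n) \<and> finite {n. f n \<noteq> \<zero>} \<and> x = (\<Oplus>n\<in>{n. f n \<noteq> \<zero>}. f n)"
  proof (rule ex1I[where a = "component x"])
    show "(\<forall>n. component x n \<in> I \<inter> A n) \<and> finite {n. component x n \<noteq> \<zero>} \<and>
      x = (\<Oplus>n\<in>{n. component x n \<noteq> \<zero>}. component x n)"
      using component_props[OF xc] c[OF x] by blast
    show "f = component x" if "(\<forall>n. f n \<in> I \<inter> A n) \<and> finite {n. f n \<noteq> \<zero>} \<and>
      x = (\<Oplus>n\<in>{n. f n \<noteq> \<zero>}. f n)" for f
      by (rule component_eqI[symmetric, where D = "{n. f n \<noteq> \<zero>}"]) (use that in blast)+
  qed
qed

lemma mult_eq_component_sum: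
  assumes r: "r \<in> carrier R" and x: "x \<in> carrier R"
  shows "r \<otimes> x = (\<Oplus>i\<in>{i. component r i \<noteq> \<zero>}. component r i \<otimes> x)"
proof -
  have "r \<otimes> x = (\<Oplus>i\<in>{i. component r i \<noteq> \<zero>}. component r i) \<otimes> x"
    using component_props(3)[OF r] by simp
  also have "\<dots> = (\<Oplus>i\<in>{i. component r i \<noteq> \<zero>}. component r i \<otimes> x)"
    by (rule finsum_ldistr) (use r x component_props(2) in auto)
  finally show ?thesis .
qed

end

section \<open>Integrality of homogeneous elements of positive degree\<close>

context ring
begin

text \<open>Horner's rule, for extending an equation of integral dependence by one degree.\<close>

lemma finsum_powers_Suc:
  assumes a: "a \<in> carrier R" and r: "\<And>i. i < m \<Longrightarrow> r i \<in> carrier R" and c: "c \<in> carrier R"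
  shows "(\<Oplus>i\<in>{..<Suc m}. (case i of 0 \<Rightarrow> c | Suc i \<Rightarrow> r i) \<otimes> a [^] i)
    = (\<Oplus>i\<in>{..<m}. r i \<otimes> a [^] i) \<otimes> a \<oplus> c"
proof -
  let ?g = "\<lambda>i. (case i of 0 \<Rightarrow> c | Suc i \<Rightarrow> r i) \<otimes> a [^] i"
  have g: "?g \<in> Suc ` {..<m} \<rightarrow> carrier R" using a r by auto
  have "(\<Oplus>i\<in>{..<Suc m}. ?g i) = (\<Oplus>i\<in>insert 0 (Suc ` {..<m}). ?g i)"
    by (simp only: lessThan_Suc_eq_insert_0)
  also have "\<dots> = ?g 0 \<oplus> (\<Oplus>i\<in>Suc ` {..<m}. ?g i)"
    by (rule finsum_insert) (use g c in auto)
  also have "(\<Oplus>i\<in>Suc ` {..<m}. ?g i) = (\<Oplus>i\<in>{..<m}. ?g (Suc i))"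
    by (rule finsum_reindex) (use g in auto)
  also have "\<dots> = (\<Oplus>i\<in>{..<m}. (r i \<otimes> a [^] i) \<otimes> a)"
    by (rule finsum_cong') (use a r in \<open>auto simp: m_assoc\<close>)
  also have "\<dots> = (\<Oplus>i\<in>{..<m}. r i \<otimes> a [^] i) \<otimes> a"
    by (rule finsum_ldistr[symmetric]) (use a r in auto)
  finally have "(\<Oplus>i\<in>{..<Suc m}. ?g i) = ?g 0 \<oplus> (\<Oplus>i\<in>{..<m}. r i \<otimes> a [^] i) \<otimes> a" .
  moreover have "(\<Oplus>i\<in>{..<m}. r i \<otimes> a [^] i) \<in> carrier R"
    using a r by (auto intro!: finsum_closed)
  ultimately show ?thesis using a c by (simp add: a_comm)
qed

end

context graded_ring
begin

lemma integral_if_radical: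
  assumes I: "graded_left_ideal R A I" and n: "n \<ge> 1"
    and a: "a \<in> A n" "a \<in> jacobson_radical R I"
  shows "integral_element R I a"
proof -
  note IL = graded_left_idealD(1)[OF I] and Ic = graded_left_idealD(2)[OF I]
  note ID = left_idealD[OF IL]
  have ac: "a \<in> carrier R" using a(1) by simp
  let ?L = "{u \<oplus> v | u v. u \<in> {r \<otimes> (\<one> \<ominus> a) | r. r \<in> carrier R} \<and> v \<in> I}"
  have L: "left_ideal ?L R"
    by (rule left_ideal_add[OF left_ideal_principal IL]) (use ac in simp)
  have "I \<subseteq> ?L"
  proof
    fix v assume v: "v \<in> I"
    then have "v = \<zero> \<otimes> (\<one> \<ominus> a) \<oplus> v" using ac ID(1) by auto
    then show "v \<in> ?L" using v by blast
  qed
  moreover have "\<one> \<ominus> a \<in> ?L"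
  proof -
    have "\<one> \<ominus> a = \<one> \<otimes> (\<one> \<ominus> a) \<oplus> \<zero>" using ac by simp
    then show ?thesis using ID(2) by blast
  qed
  ultimately have "\<one> \<in> ?L" using one_mem_if_one_minus_radical_mem[OF L _ a(2)] by blast
  then obtain b v where b: "b \<in> carrier R" and v: "v \<in> I"
    and eq: "\<one> = b \<otimes> (\<one> \<ominus> a) \<oplus> v" by blast
  have vc: "v \<in> carrier R" using v ID(1) by blast
  have "(b \<otimes> (\<one> \<ominus> a) \<oplus> v) \<oplus> b \<otimes> a = b \<otimes> \<one> \<oplus> v" using b vc ac by algebra
  then have sum_eq: "\<one> \<oplus> b \<otimes> a = b \<oplus> v" using eq b by simp
  have comps: "component \<one> k \<oplus> component (b \<otimes> a) k = component b k \<oplus> component v k" for k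
    using component_add[of \<one> "b \<otimes> a" k] component_add[of b v k] sum_eq b vc ac by simp
  have rec: "component b (k + n) = component b k \<otimes> a \<oplus> (\<ominus> component v (k + n))" for k
  proof -
    have "component \<one> (k + n) = \<zero>" using n component_homogeneous[OF one_degree_zero] by simp
    then have "component b k \<otimes> a = component b (k + n) \<oplus> component v (k + n)"
      using comps[of "k + n"] component_mult_right(1)[OF a(1) b] b ac by simp
    then show ?thesis using b vc ac by (simp add: a_assoc r_neg)
  qed
  have start: "component b 0 = \<one> \<oplus> (\<ominus> component v 0)"
  proof -
    have "component b 0 \<oplus> component v 0 = \<one>"
      using comps[of 0] component_mult_right(2)[OF a(1) b, of 0] n
        component_homogeneous[OF one_degree_zero, of 0] by simp
    from this[symmetric] show ?thesis using b vc by (simp add: a_assoc r_neg)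
  qed
  \<comment> \<open>Up to corrections by components of \<open>v\<close>, the component of \<open>b\<close> in degree \<open>j * n\<close> is \<open>a [^] j\<close>. But \<open>I\<close> is not a right
    ideal: the correction in degree \<open>0\<close> ends up in front of the leading power, as \<open>v\<^sub>0 \<otimes> a [^] j\<close>.
    The extra factor \<open>a\<close> on the left turns it into \<open>(a \<otimes> v\<^sub>0) \<otimes> a [^] j\<close>, a term of
    lower order with coefficient in \<open>I\<close>, and keeps the equation monic.\<close>
  have main: "\<exists>r. (\<forall>i<Suc j. r i \<in> I) \<and>
    a \<otimes> component b (j * n) = a [^] Suc j \<oplus> (\<Oplus>i\<in>{..<Suc j}. r i \<otimes> a [^] i)" for j
  proof (induction j)
    case 0
    let ?c = "(\<ominus> a) \<otimes> component v 0"
    have cI: "?c \<in> I" using ID(5)[OF _ Ic[OF v]] ac by simp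
    then have cc: "?c \<in> carrier R" using ID(1) by blast
    have "a \<otimes> component b 0 = a \<oplus> ?c"
      unfolding start using ac component_closed[OF vc, of 0] by (simp add: r_distr r_minus l_minus)
    then show ?case using cI cc ac by (intro exI[of _ "\<lambda>_. ?c"]) (simp add: lessThan_Suc)
  next
    case (Suc j)
    then obtain r where r: "\<forall>i<Suc j. r i \<in> I"
      and IH: "a \<otimes> component b (j * n) = a [^] Suc j \<oplus> (\<Oplus>i\<in>{..<Suc j}. r i \<otimes> a [^] i)" by blast
    have rc: "r i \<in> carrier R" if "i < Suc j" for i using r that ID(1) by blast
    let ?S = "\<Oplus>i\<in>{..<Suc j}. r i \<otimes> a [^] i"
    have Sc: "?S \<in> carrier R" using rc ac by (intro finsum_closed) auto
    let ?v = "component v (j * n + n)"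
    let ?c = "(\<ominus> a) \<otimes> ?v"
    let ?r = "\<lambda>i. case i of 0 \<Rightarrow> ?c | Suc i \<Rightarrow> r i"
    have cI: "?c \<in> I" using ID(5)[OF _ Ic[OF v]] ac by simp
    then have cc: "?c \<in> carrier R" using ID(1) by blast
    have "a \<otimes> component b (j * n + n) = (a \<otimes> component b (j * n)) \<otimes> a \<oplus> ?c"
      unfolding rec using ac component_closed[OF vc, of "j * n + n"] component_closed[OF b, of "j * n"]
      by algebra
    also have "\<dots> = a [^] Suc j \<otimes> a \<oplus> (?S \<otimes> a \<oplus> ?c)"
      unfolding IH using Sc ac cc nat_pow_closed[OF ac, of "Suc j"] by (simp only: l_distr a_assoc m_closed)
    also have "?S \<otimes> a \<oplus> ?c = (\<Oplus>i\<in>{..<Suc (Suc j)}. ?r i \<otimes> a [^] i)"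
      by (rule finsum_powers_Suc[symmetric]) (use ac rc cc in auto)
    finally have "a \<otimes> component b (Suc j * n)
      = a [^] Suc (Suc j) \<oplus> (\<Oplus>i\<in>{..<Suc (Suc j)}. ?r i \<otimes> a [^] i)"
      by (simp add: add.commute)
    moreover have "\<forall>i<Suc (Suc j). ?r i \<in> I" using r cI by (auto split: nat.split)
    ultimately show ?case by blast
  qed
  obtain j where j: "\<forall>i\<in>{i. component b i \<noteq> \<zero>}. i < j"
    using component_props(2)[OF b] finite_nat_set_iff_bounded by blast
  have "\<not> j * n < j" using n by (cases n) auto
  then have "component b (j * n) = \<zero>" using j by blast
  with main[of j] obtain r where "\<forall>i<Suc j. r i \<in> I"
    "a [^] Suc j \<oplus> (\<Oplus>i\<in>{..<Suc j}. r i \<otimes> a [^] i) = \<zero>" using ac by auto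
  then show ?thesis unfolding integral_element_def using ac by (intro conjI exI[of _ "Suc j"]) auto
qed

end

section \<open>The twisted module of periodic functions\<close>

text \<open>The module \<open>W\<close> of periodic functions with values in \<open>R/M\<close> is represented by functions with
  values in \<open>R\<close>; those with values in \<open>M\<close> represent zero, and submodules are represented by their
  full preimages. The period \<open>n\<close> is a parameter of the locale because in the end two different
  periods are compared.\<close>

locale periodic_functions = graded_ring +
  fixes n :: nat and I M :: "'a set"
  assumes period_pos: "n \<ge> 1"
    and graded_I: "graded_left_ideal R A I"
    and maximal_M: "maximal_left_ideal M R"
    and I_subset_M: "I \<subseteq> M"
begin

definition periodic :: "(int \<Rightarrow> 'a) set" where
  "periodic = {w. (\<forall>k. w k \<in> carrier R) \<and> (\<forall>k. w (k + int n) = w k)}"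

definition negligible :: "(int \<Rightarrow> 'a) set" where
  "negligible = {w \<in> periodic. \<forall>k. w k \<in> M}"

definition twisted_submodule :: "(int \<Rightarrow> 'a) set \<Rightarrow> bool" where
  "twisted_submodule X \<longleftrightarrow> negligible \<subseteq> X \<and> X \<subseteq> periodic \<and>
     (\<forall>v\<in>X. \<forall>w\<in>X. (\<lambda>k. v k \<oplus> w k) \<in> X) \<and>
     (\<forall>i. \<forall>s\<in>A i. \<forall>w\<in>X. (\<lambda>k. s \<otimes> w (k - int i)) \<in> X)"

text \<open>The result of applying \<open>s\<close> to the function that is \<open>\<one>\<close> on the residue class of \<open>t\<close> and \<open>\<zero>\<close>
  elsewhere: its value at \<open>k\<close> collects the components of \<open>s\<close> in degrees congruent to \<open>k - t\<close>.\<close>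

definition spread :: "'a \<Rightarrow> int \<Rightarrow> int \<Rightarrow> 'a" where
  "spread s t = (\<lambda>k. \<Oplus>i\<in>{i. component s i \<noteq> \<zero>}.
     if int n dvd k - t - int i then component s i else \<zero>)"

lemma M_left_ideal: "left_ideal M R" and one_notin_M: "\<one> \<notin> M"
  using maximal_left_idealD(1,2)[OF maximal_M] .

lemmas MD = left_idealD[OF M_left_ideal]

lemma I_left_ideal: "left_ideal I R" using graded_left_idealD(1)[OF graded_I] .

lemma periodicD:
  assumes "w \<in> periodic"
  shows "w k \<in> carrier R" "w (k + int n) = w k"
  using assms by (auto simp: periodic_def)

lemma periodicI:
  assumes "\<And>k. w k \<in> carrier R" "\<And>k. w (k + int n) = w k"
  shows "w \<in> periodic"
  using assms by (auto simp: periodic_def)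

lemma periodic_shift:
  assumes w: "w \<in> periodic"
  shows "(\<lambda>k. w (k + j)) \<in> periodic"
proof (rule periodicI)
  show "w (k + j) \<in> carrier R" for k using periodicD(1)[OF w] .
  have "k + int n + j = (k + j) + int n" for k by simp
  then show "w (k + int n + j) = w (k + j)" for k using periodicD(2)[OF w, of "k + j"] by (simp only:)
qed

lemma periodic_add: "v \<in> periodic \<Longrightarrow> w \<in> periodic \<Longrightarrow> (\<lambda>k. v k \<oplus> w k) \<in> periodic"
  by (rule periodicI) (simp_all add: periodicD)

lemma periodic_mult: "r \<in> carrier R \<Longrightarrow> w \<in> periodic \<Longrightarrow> (\<lambda>k. r \<otimes> w k) \<in> periodic"
  by (rule periodicI) (simp_all add: periodicD)

lemma periodic_act:
  assumes "s \<in> A i" "w \<in> periodic"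
  shows "(\<lambda>k. s \<otimes> w (k - int i)) \<in> periodic"
  using periodic_mult[OF degree_closed[OF assms(1)] periodic_shift[OF assms(2), of "- int i"]] by simp

lemma periodic_mod:
  assumes "w \<in> periodic"
  shows "w (k mod int n) = w k"
proof -
  have nat: "w (j + int n * int m) = w j" for m j
  proof (induction m)
    case (Suc m)
    have "w (j + int n * int (Suc m)) = w ((j + int n * int m) + int n)"
      by (simp add: algebra_simps)
    then show ?case using periodicD(2)[OF assms] Suc by simp
  qed simp
  have "w (j + int n * d) = w j" for d j
  proof (cases "d \<ge> 0")
    case True
    then show ?thesis using nat[of j "nat d"] by simp
  next
    case False
    then show ?thesis using nat[of "j + int n * d" "nat (- d)"] by simp
  qed
  from this[of "k mod int n" "k div int n"] show ?thesis by (simp add: add.commute)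
qed

lemma negligibleD: "w \<in> negligible \<Longrightarrow> w \<in> periodic" "w \<in> negligible \<Longrightarrow> w k \<in> M"
  by (auto simp: negligible_def)

lemma twisted_submoduleD:
  assumes "twisted_submodule X"
  shows "w \<in> negligible \<Longrightarrow> w \<in> X" "w \<in> X \<Longrightarrow> w \<in> periodic"
    "v \<in> X \<Longrightarrow> w \<in> X \<Longrightarrow> (\<lambda>k. v k \<oplus> w k) \<in> X"
    "s \<in> A i \<Longrightarrow> w \<in> X \<Longrightarrow> (\<lambda>k. s \<otimes> w (k - int i)) \<in> X"
  using assms by (auto simp: twisted_submodule_def)

lemma zero_negligible: "(\<lambda>k. \<zero>) \<in> negligible"
  using MD(2) by (auto simp: negligible_def periodic_def)

lemma twisted_submodule_finsum:
  assumes X: "twisted_submodule X" and "finite D" "\<And>i. i \<in> D \<Longrightarrow> f i \<in> X"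
  shows "(\<lambda>k. \<Oplus>i\<in>D. f i k) \<in> X"
  using assms(2,3)
proof (induction D rule: finite_induct)
  case empty
  then show ?case using twisted_submoduleD(1)[OF X zero_negligible] by simp
next
  case (insert i D)
  have c: "f j k \<in> carrier R" if "j \<in> insert i D" for j k
    using insert.prems[OF that] twisted_submoduleD(2)[OF X] periodicD(1) by blast
  have "(\<lambda>k. \<Oplus>j\<in>insert i D. f j k) = (\<lambda>k. f i k \<oplus> (\<Oplus>j\<in>D. f j k))"
    by (rule ext, rule finsum_insert) (use insert.hyps c in auto)
  then show ?case using insert twisted_submoduleD(3)[OF X] by simp
qed

lemma spread_eq:
  assumes s: "s \<in> carrier R" and D: "finite D" "\<And>i. i \<notin> D \<Longrightarrow> component s i = \<zero>"
  shows "spread s t k = (\<Oplus>i\<in>D. if int n dvd k - t - int i then component s i else \<zero>)"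
  unfolding spread_def
  by (rule add.finprod_mono_neutral_cong_left) (use s D in auto)

lemma spread_periodic:
  assumes s: "s \<in> carrier R"
  shows "spread s t \<in> periodic"
proof (rule periodicI)
  show "spread s t k \<in> carrier R" for k
    unfolding spread_def using s by (intro finsum_closed) auto
  have "int n dvd k + int n - t - int i \<longleftrightarrow> int n dvd k - t - int i" for k i
    by (metis add_diff_eq diff_add_eq dvd_add_triv_right_iff)
  then show "spread s t (k + int n) = spread s t k" for k by (simp add: spread_def)
qed

lemma spread_shift: "spread s t (k + j) = spread s (t - j) k"
  by (simp add: spread_def algebra_simps)

lemma spread_mod: "spread s (t mod int n) = spread s t"
proof -
  have "int n dvd k - t mod int n - i \<longleftrightarrow> int n dvd k - t - i" for k i
  proof -
    have "t = int n * (t div int n) + t mod int n" by simp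
    then have eq: "k - t mod int n - i = (k - t - i) + int n * (t div int n)" by linarith
    show ?thesis unfolding eq by (rule dvd_add_left_iff) simp
  qed
  then show ?thesis by (simp add: spread_def)
qed

lemma spread_add:
  assumes x: "x \<in> carrier R" and y: "y \<in> carrier R"
  shows "spread (x \<oplus> y) t k = spread x t k \<oplus> spread y t k"
proof -
  let ?D = "{i. component x i \<noteq> \<zero>} \<union> {i. component y i \<noteq> \<zero>}"
  let ?h = "\<lambda>s i. if int n dvd k - t - int i then component s i else \<zero>"
  have D: "finite ?D" using component_props(2) x y by simp
  have "spread (x \<oplus> y) t k = (\<Oplus>i\<in>?D. ?h (x \<oplus> y) i)"
    by (rule spread_eq) (use D x y component_add in auto)
  also have "\<dots> = (\<Oplus>i\<in>?D. ?h x i \<oplus> ?h y i)"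
    by (rule finsum_cong') (use x y component_add in auto)
  also have "\<dots> = (\<Oplus>i\<in>?D. ?h x i) \<oplus> (\<Oplus>i\<in>?D. ?h y i)"
    by (rule finsum_addf) (use x y in auto)
  also have "\<dots> = spread x t k \<oplus> spread y t k"
    using spread_eq[OF x D] spread_eq[OF y D] by simp
  finally show ?thesis .
qed

lemma spread_act:
  assumes r: "r \<in> A m" and x: "x \<in> carrier R"
  shows "spread (r \<otimes> x) t k = r \<otimes> spread x t (k - int m)"
proof -
  let ?D = "{i. component x i \<noteq> \<zero>}"
  let ?h = "\<lambda>k s i. if int n dvd k - t - int i then component s i else \<zero>"
  have D: "finite ?D" using component_props(2) x by simp
  have rc: "r \<in> carrier R" using r by simp
  have supp: "component (r \<otimes> x) i = \<zero>" if "i \<notin> (+) m ` ?D" for i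
  proof (cases "i < m")
    case False
    then have i: "i = m + (i - m)" by simp
    then have "component x (i - m) = \<zero>" using that by blast
    then show ?thesis using component_mult_left(1)[OF r x, of "i - m"] i rc by simp
  qed (rule component_mult_left(2)[OF r x])
  have "spread (r \<otimes> x) t k = (\<Oplus>i\<in>(+) m ` ?D. ?h k (r \<otimes> x) i)"
    by (rule spread_eq) (use rc x D supp in auto)
  also have "\<dots> = (\<Oplus>i\<in>?D. ?h k (r \<otimes> x) (m + i))"
    by (rule finsum_reindex) (use rc x in auto)
  also have "\<dots> = (\<Oplus>i\<in>?D. r \<otimes> ?h (k - int m) x i)"
    by (rule finsum_cong') (use rc x component_mult_left(1)[OF r x] in \<open>auto simp: algebra_simps\<close>)
  also have "\<dots> = r \<otimes> (\<Oplus>i\<in>?D. ?h (k - int m) x i)"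
    by (rule finsum_rdistr[symmetric]) (use rc x D in auto)
  finally show ?thesis by (simp add: spread_def)
qed

lemma spread_negligible:
  assumes "s \<in> I"
  shows "spread s t \<in> negligible"
proof -
  have "s \<in> carrier R" using assms left_idealD(1)[OF I_left_ideal] by blast
  moreover have "spread s t k \<in> M" for k
    unfolding spread_def
    by (rule left_ideal_finsum[OF M_left_ideal])
      (use graded_left_idealD(2)[OF graded_I assms] I_subset_M MD(2) in auto)
  ultimately show ?thesis using spread_periodic by (simp add: negligible_def)
qed

text \<open>This transports questions about \<open>W\<close> to left ideals of \<open>R\<close>, where the radical can be used. The
  definition of a submodule speaks of homogeneous scalars; arbitrary ones are sums of these.\<close>

lemma left_ideal_spread:
  assumes X: "twisted_submodule X"
  shows "left_ideal {s \<in> carrier R. spread s t \<in> X} R"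
proof (rule left_idealI')
  note XD = twisted_submoduleD[OF X]
  let ?L = "{s \<in> carrier R. spread s t \<in> X}"
  show "?L \<subseteq> carrier R" by blast
  show zero: "\<zero> \<in> ?L"
    using XD(1) spread_negligible left_idealD(2)[OF I_left_ideal] by blast
  show add: "x \<oplus> y \<in> ?L" if "x \<in> ?L" "y \<in> ?L" for x y
  proof -
    have "spread (x \<oplus> y) t = (\<lambda>k. spread x t k \<oplus> spread y t k)"
      using spread_add that by blast
    then show ?thesis using XD(3) that by simp
  qed
  have hom: "r \<otimes> x \<in> ?L" if "r \<in> A m" "x \<in> ?L" for r x m
  proof -
    have "spread (r \<otimes> x) t = (\<lambda>k. r \<otimes> spread x t (k - int m))"
      using spread_act that by blast
    then show ?thesis using XD(4) that by simp
  qed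
  show "r \<otimes> x \<in> ?L" if r: "r \<in> carrier R" and x: "x \<in> ?L" for r x
  proof -
    have "(\<Oplus>i\<in>D. component r i \<otimes> x) \<in> ?L" if "finite D" for D
      using that
    proof (induction D rule: finite_induct)
      case (insert i D)
      have "(\<Oplus>i\<in>insert i D. component r i \<otimes> x) = component r i \<otimes> x \<oplus> (\<Oplus>i\<in>D. component r i \<otimes> x)"
        by (rule finsum_insert) (use insert.hyps r x in auto)
      then show ?case using add[OF hom[OF component_props(1)[OF r] x] insert.IH] by simp
    qed (use zero in simp)
    then show ?thesis using mult_eq_component_sum[OF r, of x] component_props(2)[OF r] x by simp
  qed
qed

section \<open>Nakayama's lemma for periodic functions\<close>

text \<open>Adding the multiples of a single generator by the radical: writing the generator itself in the
  assumed form shows that \<open>\<one> \<ominus> c\<close> maps it into \<open>X\<close> for some \<open>c\<close> in the radical, hence so does the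
  whole ring.\<close>

lemma nakayama_step:
  assumes X: "twisted_submodule X"
    and gen: "\<And>w. w \<in> periodic \<Longrightarrow> \<exists>x\<in>X. \<exists>c\<in>jacobson_radical R I. w = (\<lambda>k. x k \<oplus> spread c t k)"
  shows "X = periodic"
proof -
  note XD = twisted_submoduleD[OF X]
  let ?L = "{s \<in> carrier R. spread s t \<in> X}"
  have L: "left_ideal ?L R" using left_ideal_spread[OF X] .
  obtain x c where x: "x \<in> X" and c: "c \<in> jacobson_radical R I"
    and eq: "spread \<one> t = (\<lambda>k. x k \<oplus> spread c t k)"
    using gen[OF spread_periodic[OF one_closed]] by blast
  have cc: "c \<in> carrier R" using jacobson_radicalD(1)[OF c] .
  have "spread (\<one> \<ominus> c) t = x"
  proof
    fix k
    have "(\<one> \<ominus> c) \<oplus> c = \<one>" using cc by algebra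
    then have "spread (\<one> \<ominus> c) t k \<oplus> spread c t k = x k \<oplus> spread c t k"
      using spread_add[of "\<one> \<ominus> c" c t k] cc eq by simp
    then show "spread (\<one> \<ominus> c) t k = x k"
      using periodicD(1)[OF spread_periodic] periodicD(1)[OF XD(2)[OF x]] cc by simp
  qed
  then have "\<one> \<ominus> c \<in> ?L" using x cc by simp
  moreover have "I \<subseteq> ?L"
    using left_idealD(1)[OF I_left_ideal] XD(1) spread_negligible by blast
  ultimately have "?L = carrier R"
    using one_mem_if_one_minus_radical_mem[OF L _ c] left_ideal_eq_carrier[OF L] by blast
  then have "spread s t \<in> X" if "s \<in> carrier R" for s using that by blast
  then have "w \<in> X" if "w \<in> periodic" for w
    using gen[OF that] XD(3) jacobson_radicalD(1) by blast
  then show ?thesis using XD(2) by blast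
qed

lemma twisted_submodule_adjoin:
  assumes X: "twisted_submodule X"
  shows "twisted_submodule {(\<lambda>k. x k \<oplus> spread c t k) | x c. x \<in> X \<and> c \<in> jacobson_radical R I}"
    (is "twisted_submodule ?Y")
    and "X \<subseteq> {(\<lambda>k. x k \<oplus> spread c t k) | x c. x \<in> X \<and> c \<in> jacobson_radical R I}"
proof -
  note XD = twisted_submoduleD[OF X] and N = left_idealD[OF jacobson_radical_left_ideal[of I]]
  have "spread \<zero> t = (\<lambda>k. \<zero>)" unfolding spread_def
    using component_homogeneous[OF degree_zero] by simp
  then have "x = (\<lambda>k. x k \<oplus> spread \<zero> t k)" if "x \<in> X" for x
    using periodicD(1)[OF XD(2)[OF that]] by simp
  then show sub: "X \<subseteq> ?Y" using N(2) by blast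
  show "twisted_submodule ?Y" unfolding twisted_submodule_def
  proof (intro conjI ballI allI)
    show "negligible \<subseteq> ?Y" using sub XD(1) by blast
    show "?Y \<subseteq> periodic" using XD(2) N(1) periodic_add spread_periodic by blast
    fix v assume "v \<in> ?Y"
    then obtain x c where v: "v = (\<lambda>k. x k \<oplus> spread c t k)" "x \<in> X" "c \<in> jacobson_radical R I" by blast
    have c: "c \<in> carrier R" using v(3) N(1) by blast
    have vc: "x k \<in> carrier R" "spread c t k \<in> carrier R" for k
      using periodicD(1) XD(2) v(2) spread_periodic c by blast+
    show "(\<lambda>k. v k \<oplus> w k) \<in> ?Y" if "w \<in> ?Y" for w
    proof -
      from that obtain y d where w: "w = (\<lambda>k. y k \<oplus> spread d t k)" "y \<in> X" "d \<in> jacobson_radical R I" by blast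
      have d: "d \<in> carrier R" using w(3) N(1) by blast
      have wc: "y k \<in> carrier R" "spread d t k \<in> carrier R" for k
        using periodicD(1) XD(2) w(2) spread_periodic d by blast+
      have "(\<lambda>k. v k \<oplus> w k) = (\<lambda>k. (x k \<oplus> y k) \<oplus> spread (c \<oplus> d) t k)"
        unfolding v w using spread_add[OF c d] vc wc by (auto simp: a_ac)
      then show ?thesis using XD(3)[OF v(2) w(2)] N(3)[OF v(3) w(3)] by fast
    qed
    show "(\<lambda>k. s \<otimes> v (k - int i)) \<in> ?Y" if s: "s \<in> A i" for i s
    proof -
      have "(\<lambda>k. s \<otimes> v (k - int i)) = (\<lambda>k. s \<otimes> x (k - int i) \<oplus> spread (s \<otimes> c) t k)"
        unfolding v using spread_act[OF s c] vc s by (simp add: r_distr)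
      then show ?thesis using XD(4)[OF s v(2)] N(5)[OF degree_closed[OF s] v(3)] by fast
    qed
  qed
qed

text \<open>The generators are adjoined one at a time. Adjoining only the last one yields a submodule to
  which the induction hypothesis applies, and \<open>nakayama_step\<close> removes it again. Speaking of all
  submodules \<open>Y\<close> above the generators avoids naming the intermediate sums.\<close>

lemma nakayama_finite:
  assumes "twisted_submodule X"
    and "\<And>Y. twisted_submodule Y \<Longrightarrow> X \<subseteq> Y \<Longrightarrow>
      (\<And>t c. t < m \<Longrightarrow> c \<in> jacobson_radical R I \<Longrightarrow> spread c (int t) \<in> Y) \<Longrightarrow> Y = periodic"
  shows "X = periodic"
  using assms
proof (induction m arbitrary: X)
  case 0
  then show ?case by blast
next
  case (Suc m)
  let ?Y = "{(\<lambda>k. x k \<oplus> spread c (int m) k) | x c. x \<in> X \<and> c \<in> jacobson_radical R I}"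
  note adj = twisted_submodule_adjoin[OF Suc.prems(1), of "int m"]
  have gen: "spread c (int m) \<in> ?Y" if c: "c \<in> jacobson_radical R I" for c
  proof -
    have "spread c (int m) = (\<lambda>k. \<zero> \<oplus> spread c (int m) k)"
      using periodicD(1)[OF spread_periodic[OF jacobson_radicalD(1)[OF c]]] by simp
    moreover have "(\<lambda>k. \<zero>) \<in> X" using twisted_submoduleD(1)[OF Suc.prems(1) zero_negligible] .
    ultimately show ?thesis using c by fast
  qed
  have "?Y = periodic"
  proof (rule Suc.IH[OF adj(1)])
    fix Z assume Z: "twisted_submodule Z" "?Y \<subseteq> Z"
      "\<And>t c. t < m \<Longrightarrow> c \<in> jacobson_radical R I \<Longrightarrow> spread c (int t) \<in> Z"
    show "Z = periodic"
    proof (rule Suc.prems(2)[OF Z(1)])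
      show "X \<subseteq> Z" using adj(2) Z(2) by (rule subset_trans)
      show "spread c (int t) \<in> Z" if "t < Suc m" "c \<in> jacobson_radical R I" for t c
      proof (cases "t = m")
        case True
        then show ?thesis using gen[OF that(2)] Z(2) by blast
      next
        case False
        then show ?thesis using Z(3) that by simp
      qed
    qed
  qed
  then show ?case using nakayama_step[OF Suc.prems(1), of "int m"] by blast
qed

text \<open>The submodule \<open>U\<close>. It is generated by all translates at once, so that it is visibly invariant
  under translation.\<close>

inductive_set radical_span :: "(int \<Rightarrow> 'a) set" where
  negligible: "w \<in> negligible \<Longrightarrow> w \<in> radical_span"
| spread: "c \<in> jacobson_radical R I \<Longrightarrow> spread c t \<in> radical_span"
| add: "v \<in> radical_span \<Longrightarrow> w \<in> radical_span \<Longrightarrow> (\<lambda>k. v k \<oplus> w k) \<in> radical_span"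
| act: "s \<in> A i \<Longrightarrow> w \<in> radical_span \<Longrightarrow> (\<lambda>k. s \<otimes> w (k - int i)) \<in> radical_span"

lemma radical_span_periodic: "w \<in> radical_span \<Longrightarrow> w \<in> periodic"
  by (induction rule: radical_span.induct)
    (auto intro: negligibleD(1) spread_periodic periodic_add periodic_act dest: jacobson_radicalD(1))

lemma radical_span_submodule: "twisted_submodule radical_span"
  unfolding twisted_submodule_def
  using radical_span_periodic by (auto intro: radical_span.intros)

lemma radical_span_shift: "w \<in> radical_span \<Longrightarrow> (\<lambda>k. w (k + j)) \<in> radical_span"
proof (induction rule: radical_span.induct)
  case (negligible w)
  then show ?case using periodic_shift
    by (auto intro!: radical_span.negligible simp: negligible_def)
next
  case (spread c t)
  then show ?case using radical_span.spread[OF spread, of "t - j"] by (simp add: spread_shift)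
next
  case (add v w)
  then show ?case by (simp add: radical_span.add)
next
  case (act s i w)
  then show ?case using radical_span.act[OF act(1,3)] by (simp add: algebra_simps)
qed

text \<open>Translating by \<open>i\<close> before letting the component of degree \<open>i\<close> act cancels the twist.\<close>

lemma radical_span_mult:
  assumes r: "r \<in> carrier R" and w: "w \<in> radical_span"
  shows "(\<lambda>k. r \<otimes> w k) \<in> radical_span"
proof -
  let ?D = "{i. component r i \<noteq> \<zero>}"
  have "(\<lambda>k. component r i \<otimes> w k) \<in> radical_span" for i
    using radical_span.act[OF component_props(1)[OF r, of i] radical_span_shift[OF w, of "int i"]] by simp
  then have "(\<lambda>k. \<Oplus>i\<in>?D. component r i \<otimes> w k) \<in> radical_span"
    using twisted_submodule_finsum[OF radical_span_submodule component_props(2)[OF r],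
      of "\<lambda>i k. component r i \<otimes> w k"] by blast
  moreover have "r \<otimes> w k = (\<Oplus>i\<in>?D. component r i \<otimes> w k)" for k
    using mult_eq_component_sum[OF r] periodicD(1)[OF radical_span_periodic[OF w]] by blast
  ultimately show ?thesis by simp
qed

lemma nakayama:
  assumes X: "twisted_submodule X"
    and gen: "\<And>w. w \<in> periodic \<Longrightarrow> \<exists>x\<in>X. \<exists>u\<in>radical_span. w = (\<lambda>k. x k \<oplus> u k)"
  shows "X = periodic"
proof (rule nakayama_finite[OF X, where m = n])
  fix Y assume Y: "twisted_submodule Y" "X \<subseteq> Y"
    and spr: "\<And>t c. t < n \<Longrightarrow> c \<in> jacobson_radical R I \<Longrightarrow> spread c (int t) \<in> Y"
  note YD = twisted_submoduleD[OF Y(1)]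
  have "u \<in> Y" if "u \<in> radical_span" for u
    using that
  proof (induction rule: radical_span.induct)
    case (spread c t)
    have "nat (t mod int n) < n" using period_pos by (simp add: nat_less_iff)
    from spr[OF this spread] show ?case using period_pos by (simp add: spread_mod)
  qed (auto intro: YD)
  then have "w \<in> Y" if "w \<in> periodic" for w
    using gen[OF that] YD(3) Y(2) by blast
  then show "Y = periodic" using YD(2) by blast
qed

section \<open>The averaged projection\<close>

definition cong_M :: "'a \<Rightarrow> 'a \<Rightarrow> bool" (infix \<open>\<simeq>\<close> 50) where
  "x \<simeq> y \<longleftrightarrow> x \<in> carrier R \<and> y \<in> carrier R \<and> x \<ominus> y \<in> M"

lemma cong_refl: "x \<in> carrier R \<Longrightarrow> x \<simeq> x"
  using MD(2) by (simp add: cong_M_def a_minus_def r_neg)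

lemma cong_sym:
  assumes "x \<simeq> y"
  shows "y \<simeq> x"
proof -
  have c: "x \<in> carrier R" "y \<in> carrier R" "x \<ominus> y \<in> M" using assms by (auto simp: cong_M_def)
  have "\<zero> \<ominus> (x \<ominus> y) = y \<ominus> x" using c(1,2) by algebra
  then show ?thesis using MD(4)[OF MD(2) c(3)] c by (simp add: cong_M_def)
qed

lemma cong_trans [trans]:
  assumes "x \<simeq> y" "y \<simeq> z"
  shows "x \<simeq> z"
proof -
  have c: "x \<in> carrier R" "y \<in> carrier R" "z \<in> carrier R" "x \<ominus> y \<in> M" "y \<ominus> z \<in> M"
    using assms by (auto simp: cong_M_def)
  have "(x \<ominus> y) \<oplus> (y \<ominus> z) = x \<ominus> z" using c(1-3) by algebra
  then show ?thesis using MD(3)[OF c(4,5)] c by (simp add: cong_M_def)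
qed

lemma cong_add:
  assumes "x \<simeq> y" "x' \<simeq> y'"
  shows "x \<oplus> x' \<simeq> y \<oplus> y'"
proof -
  have c: "x \<in> carrier R" "y \<in> carrier R" "x' \<in> carrier R" "y' \<in> carrier R"
    "x \<ominus> y \<in> M" "x' \<ominus> y' \<in> M"
    using assms by (auto simp: cong_M_def)
  have "(x \<ominus> y) \<oplus> (x' \<ominus> y') = (x \<oplus> x') \<ominus> (y \<oplus> y')" using c(1-4) by algebra
  then show ?thesis using MD(3)[OF c(5,6)] c by (simp add: cong_M_def)
qed

lemma cong_mult:
  assumes r: "r \<in> carrier R" and "x \<simeq> y"
  shows "r \<otimes> x \<simeq> r \<otimes> y"
proof -
  have c: "x \<in> carrier R" "y \<in> carrier R" "x \<ominus> y \<in> M" using assms by (auto simp: cong_M_def)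
  have "r \<otimes> (x \<ominus> y) = r \<otimes> x \<ominus> r \<otimes> y" using c(1,2) r by algebra
  then show ?thesis using MD(5)[OF r c(3)] c r by (simp add: cong_M_def)
qed

lemma cong_finsum:
  assumes "finite D" "\<And>i. i \<in> D \<Longrightarrow> f i \<simeq> g i"
  shows "(\<Oplus>i\<in>D. f i) \<simeq> (\<Oplus>i\<in>D. g i)"
  using assms
proof (induction D rule: finite_induct)
  case empty
  then show ?case using cong_refl by simp
next
  case (insert i D)
  have "f j \<in> carrier R" "g j \<in> carrier R" if "j \<in> insert i D" for j
    using insert.prems[OF that] by (auto simp: cong_M_def)
  then have "(\<Oplus>j\<in>insert i D. f j) = f i \<oplus> (\<Oplus>j\<in>D. f j)"
    "(\<Oplus>j\<in>insert i D. g j) = g i \<oplus> (\<Oplus>j\<in>D. g j)"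
    using insert.hyps by (auto intro!: finsum_insert)
  then show ?case using insert cong_add by simp
qed

lemma cong_zero_iff: "x \<simeq> \<zero> \<longleftrightarrow> x \<in> M"
  using MD(1) by (auto simp: cong_M_def a_minus_def)

lemma cong_imp_mem: "x \<simeq> y \<Longrightarrow> y \<in> M \<Longrightarrow> x \<in> M"
  using cong_trans[of x y \<zero>] by (simp add: cong_zero_iff)

text \<open>Sets of coordinates that determine an element of \<open>U\<close>. A minimal one identifies \<open>U\<close> with a
  power of \<open>R/M\<close>; this is how the complement that semisimplicity provides is found here.\<close>

definition separating :: "int set \<Rightarrow> bool" where
  "separating T \<longleftrightarrow> finite T \<and> (\<forall>u\<in>radical_span. (\<forall>t\<in>T. u t \<in> M) \<longrightarrow> u \<in> negligible)"

lemma separating_period: "separating {0..<int n}"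
  unfolding separating_def
proof (intro conjI ballI impI)
  fix u assume u: "u \<in> radical_span" "\<forall>t\<in>{0..<int n}. u t \<in> M"
  have "u k \<in> M" for k
  proof -
    have "u (k mod int n) \<in> M" using u(2) period_pos by simp
    then show ?thesis using periodic_mod[OF radical_span_periodic[OF u(1)]] by simp
  qed
  then show "u \<in> negligible" using radical_span_periodic[OF u(1)] by (simp add: negligible_def)
qed simp

text \<open>In a separating set of least size every coordinate \<open>t\<close> is needed, so some element of \<open>U\<close> vanishes
  at the other coordinates but not at \<open>t\<close>. As \<open>R/M\<close> is simple, its multiples take every value at \<open>t\<close>.\<close>

lemma coordinate_basis:
  obtains T where "separating T"
    and "\<And>t x. t \<in> T \<Longrightarrow> x \<in> carrier R \<Longrightarrow>
      \<exists>u\<in>radical_span. u t \<simeq> x \<and> (\<forall>s\<in>T - {t}. u s \<in> M)"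
proof -
  obtain T where T: "separating T" and min: "\<And>T'. separating T' \<Longrightarrow> card T \<le> card T'"
    using ex_has_least_nat[of separating, OF separating_period, of card] by blast
  have "\<exists>u\<in>radical_span. u t \<simeq> x \<and> (\<forall>s\<in>T - {t}. u s \<in> M)"
    if t: "t \<in> T" and x: "x \<in> carrier R" for t x
  proof -
    have fin: "finite T" using T by (simp add: separating_def)
    then have "card (T - {t}) < card T" using t by (rule card_Diff1_less)
    then have "\<not> separating (T - {t})" using min by (metis leD)
    then obtain u where u: "u \<in> radical_span" "\<forall>s\<in>T - {t}. u s \<in> M" "u \<notin> negligible"
      using fin by (auto simp: separating_def)
    have uc: "u k \<in> carrier R" for k using periodicD(1) radical_span_periodic u(1) by blast
    have "u t \<notin> M" using T u by (auto simp: separating_def)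
    then obtain r where r: "r \<in> carrier R" "\<one> \<ominus> r \<otimes> u t \<in> M"
      using left_inverse_mod_maximal[OF maximal_M uc] by blast
    let ?v = "\<lambda>k. (x \<otimes> r) \<otimes> u k"
    have "?v \<in> radical_span" using radical_span_mult u(1) r(1) x by simp
    moreover have "?v t \<simeq> x"
    proof -
      have "\<one> \<simeq> r \<otimes> u t" using r uc by (simp add: cong_M_def)
      from cong_mult[OF x cong_sym[OF this]] show ?thesis using x r(1) uc by (simp add: m_assoc)
    qed
    moreover have "\<forall>s\<in>T - {t}. ?v s \<in> M" using MD(5) u(2) x r(1) by simp
    ultimately show ?thesis by (intro bexI[of _ ?v] conjI)
  qed
  with T that show ?thesis by blast
qed

lemma coordinates_interpolate:
  assumes T: "separating T"
    and basis: "\<And>t x. t \<in> T \<Longrightarrow> x \<in> carrier R \<Longrightarrow>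
      \<exists>u\<in>radical_span. u t \<simeq> x \<and> (\<forall>s\<in>T - {t}. u s \<in> M)"
    and w: "w \<in> periodic"
  shows "\<exists>u\<in>radical_span. \<forall>t\<in>T. u t \<simeq> w t"
proof -
  have "\<exists>u\<in>radical_span. (\<forall>t\<in>F. u t \<simeq> w t) \<and> (\<forall>t\<in>T - F. u t \<in> M)" if "finite F" "F \<subseteq> T" for F
    using that
  proof (induction F rule: finite_induct)
    case empty
    then show ?case using radical_span.negligible[OF zero_negligible] MD(2)
      by (intro bexI[of _ "\<lambda>k. \<zero>"]) auto
  next
    case (insert t F)
    then obtain u where u: "u \<in> radical_span" "\<forall>s\<in>F. u s \<simeq> w s" "\<forall>s\<in>T - F. u s \<in> M" by blast
    have uc: "u k \<in> carrier R" for k using periodicD(1) radical_span_periodic u(1) by blast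
    from insert.prems basis[of t "w t"] periodicD(1)[OF w]
    obtain v where v: "v \<in> radical_span" "v t \<simeq> w t" "\<forall>s\<in>T - {t}. v s \<in> M" by blast
    let ?z = "\<lambda>k. u k \<oplus> v k"
    have "?z s \<simeq> w s" if s: "s \<in> insert t F" for s
    proof (cases "s = t")
      case True
      have "u t \<simeq> \<zero>" using u(3) insert.prems insert.hyps by (simp add: cong_zero_iff)
      then show ?thesis using cong_add[of "u t" \<zero> "v t" "w t"] v(2) periodicD(1)[OF w] True by simp
    next
      case False
      then have "v s \<simeq> \<zero>" using v(3) s insert.prems by (auto simp: cong_zero_iff)
      then show ?thesis using cong_add[of "u s" "w s" "v s" \<zero>] u(2) periodicD(1)[OF w] s False by simp
    qed
    moreover have "?z s \<in> M" if "s \<in> T - insert t F" for s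
      using u(3) v(3) that MD(3) by auto
    ultimately show ?case using radical_span.add[OF u(1) v(1)] by (intro bexI[of _ ?z]) auto
  qed
  from this[of T] T show ?thesis by (auto simp: separating_def)
qed

lemma radical_span_minus:
  assumes u: "u \<in> radical_span" and v: "v \<in> radical_span"
  shows "(\<lambda>k. u k \<ominus> v k) \<in> radical_span"
proof -
  have "v k \<in> carrier R" for k using periodicD(1) radical_span_periodic v by blast
  then show ?thesis
    using radical_span.add[OF u radical_span_mult[OF _ v, of "\<ominus> \<one>"]] by (simp add: l_minus a_minus_def)
qed

lemma separating_unique:
  assumes T: "separating T" and u: "u \<in> radical_span" and v: "v \<in> radical_span"
    and eq: "\<And>t. t \<in> T \<Longrightarrow> u t \<simeq> v t"
  shows "u k \<simeq> v k"
proof -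
  have "(\<lambda>k. u k \<ominus> v k) \<in> negligible"
    using T radical_span_minus[OF u v] eq by (auto simp: separating_def cong_M_def)
  then show ?thesis using negligibleD(2) periodicD(1) radical_span_periodic u v
    by (auto simp: cong_M_def)
qed

text \<open>Let \<open>p w\<close> be the element of \<open>U\<close> with the same coordinates as \<open>w\<close> in a minimal separating set.
  These determine it up to functions with values in \<open>M\<close>, whence \<open>p\<close> is linear up to such functions.\<close>

lemma semisimple_projection:
  obtains p where "\<And>w. w \<in> periodic \<Longrightarrow> p w \<in> radical_span"
    and "\<And>v w k. v \<in> periodic \<Longrightarrow> w \<in> periodic \<Longrightarrow> p (\<lambda>k. v k \<oplus> w k) k \<simeq> p v k \<oplus> p w k"
    and "\<And>r w k. r \<in> carrier R \<Longrightarrow> w \<in> periodic \<Longrightarrow> p (\<lambda>k. r \<otimes> w k) k \<simeq> r \<otimes> p w k"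
    and "\<And>u k. u \<in> radical_span \<Longrightarrow> p u k \<simeq> u k"
proof -
  obtain T where T: "separating T" and basis: "\<And>t x. t \<in> T \<Longrightarrow> x \<in> carrier R \<Longrightarrow>
      \<exists>u\<in>radical_span. u t \<simeq> x \<and> (\<forall>s\<in>T - {t}. u s \<in> M)"
    by (rule coordinate_basis) (rule that)
  have "\<forall>w\<in>periodic. \<exists>u. u \<in> radical_span \<and> (\<forall>t\<in>T. u t \<simeq> w t)"
    using coordinates_interpolate[OF T basis] by blast
  from bchoice[OF this] obtain p where p: "\<And>w. w \<in> periodic \<Longrightarrow> p w \<in> radical_span"
    and pT: "\<And>w t. w \<in> periodic \<Longrightarrow> t \<in> T \<Longrightarrow> p w t \<simeq> w t" by blast
  show thesis
  proof (rule that[of p])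
    show "p w \<in> radical_span" if "w \<in> periodic" for w using p that .
    show "p (\<lambda>k. v k \<oplus> w k) k \<simeq> p v k \<oplus> p w k" if v: "v \<in> periodic" and w: "w \<in> periodic" for v w k
    proof (rule separating_unique[OF T, of _ "\<lambda>k. p v k \<oplus> p w k"])
      show "p (\<lambda>k. v k \<oplus> w k) \<in> radical_span" using p periodic_add v w by blast
      show "(\<lambda>k. p v k \<oplus> p w k) \<in> radical_span" using radical_span.add p v w by blast
      show "p (\<lambda>k. v k \<oplus> w k) t \<simeq> p v t \<oplus> p w t" if t: "t \<in> T" for t
        using cong_trans[OF pT[OF periodic_add[OF v w] t] cong_sym[OF cong_add[OF pT[OF v t] pT[OF w t]]]] .
    qed
    show "p (\<lambda>k. r \<otimes> w k) k \<simeq> r \<otimes> p w k" if r: "r \<in> carrier R" and w: "w \<in> periodic" for r w k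
    proof (rule separating_unique[OF T, of _ "\<lambda>k. r \<otimes> p w k"])
      show "p (\<lambda>k. r \<otimes> w k) \<in> radical_span" using p periodic_mult r w by blast
      show "(\<lambda>k. r \<otimes> p w k) \<in> radical_span" using radical_span_mult r p w by blast
      show "p (\<lambda>k. r \<otimes> w k) t \<simeq> r \<otimes> p w t" if t: "t \<in> T" for t
        using cong_trans[OF pT[OF periodic_mult[OF r w] t] cong_sym[OF cong_mult[OF r pT[OF w t]]]] .
    qed
    show "p u k \<simeq> u k" if u: "u \<in> radical_span" for u k
      by (rule separating_unique[OF T p[OF radical_span_periodic[OF u]] u])
        (rule pT[OF radical_span_periodic[OF u]])
  qed
qed

lemma cyclic_sum_shift:
  fixes F :: "int \<Rightarrow> 'a"
  assumes "F \<in> periodic"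
  shows "(\<Oplus>i\<in>{..<n}. F (int i - int m)) = (\<Oplus>i\<in>{..<n}. F (int i))"
  using assms
proof (induction m arbitrary: F)
  case 0
  then show ?case by simp
next
  case (Suc m)
  obtain n' where n': "n = Suc n'" using period_pos by (cases n) auto
  have c: "F k \<in> carrier R" for k using Suc.prems periodicD(1) by blast
  let ?G = "\<lambda>k. F (k - 1)"
  have "?G \<in> periodic" using periodic_shift[OF Suc.prems, of "- 1"] by simp
  from Suc.IH[OF this] have "(\<Oplus>i\<in>{..<n}. F (int i - int (Suc m))) = (\<Oplus>i\<in>{..<n}. F (int i - 1))"
    by (simp add: algebra_simps)
  also have "\<dots> = (\<Oplus>i\<in>insert 0 (Suc ` {..<n'}). F (int i - 1))"
    by (simp only: n' lessThan_Suc_eq_insert_0)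
  also have "\<dots> = F (- 1) \<oplus> (\<Oplus>i\<in>Suc ` {..<n'}. F (int i - 1))"
    using c by (subst finsum_insert) auto
  also have "(\<Oplus>i\<in>Suc ` {..<n'}. F (int i - 1)) = (\<Oplus>i\<in>{..<n'}. F (int i))"
    using c by (subst finsum_reindex) auto
  also have "F (- 1) = F (int n')" using periodicD(2)[OF Suc.prems, of "- 1"] n' by simp
  also have "F (int n') \<oplus> (\<Oplus>i\<in>{..<n'}. F (int i)) = (\<Oplus>i\<in>{..<n}. F (int i))"
    using c unfolding n' lessThan_Suc by (subst finsum_insert) auto
  finally show ?case .
qed

text \<open>Maschke's averaging, without dividing by the group order. Linearity for the twisted action
  follows since the average commutes with translation.\<close>

lemma averaged_projection:
  obtains q where "\<And>w. w \<in> periodic \<Longrightarrow> q w \<in> radical_span"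
    and "\<And>v w k. v \<in> periodic \<Longrightarrow> w \<in> periodic \<Longrightarrow> q (\<lambda>k. v k \<oplus> w k) k \<simeq> q v k \<oplus> q w k"
    and "\<And>s m w k. s \<in> A m \<Longrightarrow> w \<in> periodic \<Longrightarrow>
      q (\<lambda>k. s \<otimes> w (k - int m)) k \<simeq> s \<otimes> q w (k - int m)"
    and "\<And>u k. u \<in> radical_span \<Longrightarrow> q u k \<simeq> [n] \<cdot> u k"
proof -
  obtain p where p: "\<And>w. w \<in> periodic \<Longrightarrow> p w \<in> radical_span"
    and padd: "\<And>v w k. v \<in> periodic \<Longrightarrow> w \<in> periodic \<Longrightarrow> p (\<lambda>k. v k \<oplus> w k) k \<simeq> p v k \<oplus> p w k"
    and pmult: "\<And>r w k. r \<in> carrier R \<Longrightarrow> w \<in> periodic \<Longrightarrow> p (\<lambda>k. r \<otimes> w k) k \<simeq> r \<otimes> p w k"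
    and pid: "\<And>u k. u \<in> radical_span \<Longrightarrow> p u k \<simeq> u k"
    by (rule semisimple_projection) (rule that)
  have pc: "p w k \<in> carrier R" if "w \<in> periodic" for w k
    using p[OF that] radical_span_periodic periodicD(1) by blast
  define q where "q w k = (\<Oplus>i\<in>{..<n}. p (\<lambda>j. w (j + int i)) (k - int i))" for w k
  show thesis
  proof (rule that[of q])
    show "q w \<in> radical_span" if w: "w \<in> periodic" for w
    proof -
      have "(\<lambda>k. p (\<lambda>j. w (j + int i)) (k - int i)) \<in> radical_span" for i
        using radical_span_shift[OF p[OF periodic_shift[OF w, of "int i"]], of "- int i"] by simp
      then have "(\<lambda>k. \<Oplus>i\<in>{..<n}. p (\<lambda>j. w (j + int i)) (k - int i)) \<in> radical_span"
        using twisted_submodule_finsum[OF radical_span_submodule, of "{..<n}"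
            "\<lambda>i k. p (\<lambda>j. w (j + int i)) (k - int i)"] by simp
      then show ?thesis by (simp add: q_def[abs_def])
    qed
    show "q (\<lambda>k. v k \<oplus> w k) k \<simeq> q v k \<oplus> q w k" if v: "v \<in> periodic" and w: "w \<in> periodic" for v w k
    proof -
      have "q (\<lambda>k. v k \<oplus> w k) k \<simeq>
        (\<Oplus>i\<in>{..<n}. p (\<lambda>j. v (j + int i)) (k - int i) \<oplus> p (\<lambda>j. w (j + int i)) (k - int i))"
        unfolding q_def by (rule cong_finsum) (use padd periodic_shift v w in auto)
      also have "\<dots> = q v k \<oplus> q w k"
        unfolding q_def by (rule finsum_addf) (use pc periodic_shift v w in auto)
      finally show ?thesis .
    qed
    show "q (\<lambda>k. s \<otimes> w (k - int m)) k \<simeq> s \<otimes> q w (k - int m)"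
      if s: "s \<in> A m" and w: "w \<in> periodic" for s m w k
    proof -
      let ?F = "\<lambda>e. p (\<lambda>j. w (j + e)) (k - int m - e)"
      have F: "?F \<in> periodic"
      proof (rule periodicI)
        show "?F e \<in> carrier R" for e using pc periodic_shift[OF w] by blast
        show "?F (e + int n) = ?F e" for e
        proof -
          have "(\<lambda>j. w (j + (e + int n))) = (\<lambda>j. w (j + e))"
            using periodicD(2)[OF w, of "_ + e"] by (simp add: add.assoc)
          moreover have "p (\<lambda>j. w (j + e)) (k - int m - e - int n + int n)
            = p (\<lambda>j. w (j + e)) (k - int m - e - int n)"
            by (rule periodicD(2)[OF radical_span_periodic[OF p[OF periodic_shift[OF w]]]])
          ultimately show ?thesis by (simp add: algebra_simps)
        qed
      qed
      have sc: "s \<in> carrier R" using s by simp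
      have "q (\<lambda>k. s \<otimes> w (k - int m)) k \<simeq> (\<Oplus>i\<in>{..<n}. s \<otimes> ?F (int i - int m))"
        unfolding q_def
      proof (rule cong_finsum)
        fix i
        have "p (\<lambda>j. s \<otimes> w (j + (int i - int m))) (k - int i)
          \<simeq> s \<otimes> p (\<lambda>j. w (j + (int i - int m))) (k - int i)"
          by (rule pmult[OF sc periodic_shift[OF w]])
        then show "p (\<lambda>j. s \<otimes> w (j + int i - int m)) (k - int i) \<simeq> s \<otimes> ?F (int i - int m)"
          by (simp add: algebra_simps)
      qed simp
      also have "(\<Oplus>i\<in>{..<n}. s \<otimes> ?F (int i - int m)) = s \<otimes> (\<Oplus>i\<in>{..<n}. ?F (int i - int m))"
      proof (rule finsum_rdistr[symmetric])
        show "(\<lambda>i. ?F (int i - int m)) \<in> {..<n} \<rightarrow> carrier R" using periodicD(1)[OF F] by (intro Pi_I)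
      qed (use sc in auto)
      also have "(\<Oplus>i\<in>{..<n}. ?F (int i - int m)) = (\<Oplus>i\<in>{..<n}. ?F (int i))"
        by (rule cyclic_sum_shift[OF F])
      finally show ?thesis by (simp add: q_def)
    qed
    show "q u k \<simeq> [n] \<cdot> u k" if u: "u \<in> radical_span" for u k
    proof -
      have uc: "u k \<in> carrier R" using u radical_span_periodic periodicD(1) by blast
      have "q u k \<simeq> (\<Oplus>i\<in>{..<n}. u k)"
        unfolding q_def
      proof (rule cong_finsum)
        show "p (\<lambda>j. u (j + int i)) (k - int i) \<simeq> u k" for i
          using pid[OF radical_span_shift[OF u, of "int i"], of "k - int i"] by simp
      qed simp
      also have "(\<Oplus>i\<in>{..<n}. u k) = [n] \<cdot> u k"
        using add.finprod_const[OF uc, of "{..<n}"] by simp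
      finally show ?thesis .
    qed
  qed
qed

section \<open>Components of elements of the radical\<close>

lemma multiple_one:
  shows "[n] \<cdot> \<one> \<in> A 0"
    and "x \<in> carrier R \<Longrightarrow> [n] \<cdot> x = ([n] \<cdot> \<one>) \<otimes> x"
    and "x \<in> carrier R \<Longrightarrow> [n] \<cdot> x = x \<otimes> ([n] \<cdot> \<one>)"
proof -
  have "[k] \<cdot> \<one> \<in> A 0" for k :: nat
    by (induction k) (use one_degree_zero degree_add in auto)
  then show "[n] \<cdot> \<one> \<in> A 0" .
  show "[n] \<cdot> x = ([n] \<cdot> \<one>) \<otimes> x" "[n] \<cdot> x = x \<otimes> ([n] \<cdot> \<one>)" if "x \<in> carrier R"
    using that add_pow_ldistr[of \<one> x n] add_pow_rdistr[of x \<one> n] by simp_all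
qed

text \<open>If \<open>n\<close> is invertible modulo \<open>M\<close>, the kernel \<open>X\<close> of the averaged projection \<open>q\<close> satisfies
  \<open>X + U = W\<close>: write \<open>w = n w'\<close> and split it into \<open>n w' - q w'\<close> and \<open>q w'\<close>. By Nakayama's lemma
  \<open>q\<close> vanishes, and on \<open>U\<close> it is multiplication by \<open>n\<close>.\<close>

lemma multiple_radical_span_mem:
  assumes u: "u \<in> radical_span"
  shows "[n] \<cdot> u k \<in> M"
proof (cases "[n] \<cdot> \<one> \<in> M")
  case True
  have uc: "u k \<in> carrier R" using u radical_span_periodic periodicD(1) by blast
  then show ?thesis using MD(5)[OF uc True] multiple_one(3)[OF uc] by simp
next
  case False
  let ?\<nu> = "[n] \<cdot> \<one>"
  obtain q where q: "\<And>w. w \<in> periodic \<Longrightarrow> q w \<in> radical_span"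
    and qadd: "\<And>v w k. v \<in> periodic \<Longrightarrow> w \<in> periodic \<Longrightarrow> q (\<lambda>k. v k \<oplus> w k) k \<simeq> q v k \<oplus> q w k"
    and qact: "\<And>s m w k. s \<in> A m \<Longrightarrow> w \<in> periodic \<Longrightarrow>
      q (\<lambda>k. s \<otimes> w (k - int m)) k \<simeq> s \<otimes> q w (k - int m)"
    and qn: "\<And>u k. u \<in> radical_span \<Longrightarrow> q u k \<simeq> [n] \<cdot> u k"
    by (rule averaged_projection) (rule that)
  have qc: "q w k \<in> carrier R" if "w \<in> periodic" for w k
    using q[OF that] radical_span_periodic periodicD(1) by blast
  have \<nu>c: "?\<nu> \<in> carrier R" by simp
  have negl: "q w k \<in> M" if w: "w \<in> negligible" for w k
  proof -
    have "?\<nu> \<otimes> w k \<in> M" using MD(5)[OF \<nu>c] negligibleD(2)[OF w] .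
    then have "[n] \<cdot> w k \<in> M" using multiple_one(2)[OF periodicD(1)[OF negligibleD(1)[OF w]]] by simp
    then show ?thesis using cong_imp_mem[OF qn[OF radical_span.negligible[OF w]]] by blast
  qed
  let ?X = "{w \<in> periodic. \<forall>k. q w k \<in> M}"
  have X: "twisted_submodule ?X" unfolding twisted_submodule_def
  proof (intro conjI ballI allI)
    show "negligible \<subseteq> ?X" using negl negligibleD(1) by blast
    show "?X \<subseteq> periodic" by blast
    show "(\<lambda>k. v k \<oplus> w k) \<in> ?X" if "v \<in> ?X" "w \<in> ?X" for v w
      using that periodic_add cong_imp_mem[OF qadd] MD(3) by simp
    show "(\<lambda>k. s \<otimes> w (k - int i)) \<in> ?X" if "s \<in> A i" "w \<in> ?X" for s i w
      using that periodic_act cong_imp_mem[OF qact] MD(5) by simp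
  qed
  obtain r where r: "r \<in> carrier R" "\<one> \<ominus> r \<otimes> ?\<nu> \<in> M"
    using left_inverse_mod_maximal[OF maximal_M \<nu>c False] by blast
  have cancel: "(x \<ominus> y) \<oplus> y = x" "y \<oplus> (x \<ominus> y) = x" "(x \<oplus> y) \<ominus> y = x"
    if "x \<in> carrier R" "y \<in> carrier R" for x y
    using that by algebra+
  have "?X = periodic"
  proof (rule nakayama[OF X])
    fix w assume w: "w \<in> periodic"
    have wc: "w k \<in> carrier R" for k using periodicD(1)[OF w] .
    \<comment> \<open>\<open>r\<close> stands on the right: \<open>M\<close> is only a left ideal, so the relation \<open>\<one> \<ominus> r \<otimes> ?\<nu> \<in> M\<close> can
      be multiplied by \<open>w k\<close> from the left only, and \<open>?\<nu>\<close> is central.\<close>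
    let ?w' = "\<lambda>k. w k \<otimes> r"
    have w': "?w' \<in> periodic" by (rule periodicI) (use wc r(1) periodicD(2)[OF w] in auto)
    let ?v = "\<lambda>k. ?\<nu> \<otimes> ?w' k"
    let ?z = "\<lambda>k. w k \<ominus> ?v k"
    have v: "?v \<in> periodic" using periodic_mult[OF \<nu>c w'] .
    have z: "?z \<in> negligible"
    proof -
      have "?z k = w k \<otimes> (\<one> \<ominus> r \<otimes> ?\<nu>)" for k
      proof -
        have "?v k = w k \<otimes> (r \<otimes> ?\<nu>)"
          using multiple_one(2,3)[of "w k \<otimes> r"] wc r(1) by (simp add: m_assoc)
        then show ?thesis using wc[of k] r(1) by (simp add: a_minus_def r_distr r_minus)
      qed
      then have "?z k \<in> M" for k using MD(5)[OF wc r(2)] by simp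
      moreover have "?z \<in> periodic"
        by (rule periodicI) (use wc r(1) periodicD(2)[OF w] in auto)
      ultimately show ?thesis by (simp add: negligible_def)
    qed
    let ?u = "q ?w'"
    have u: "?u \<in> radical_span" using q[OF w'] .
    have up: "?u \<in> periodic" using radical_span_periodic[OF u] .
    have uc: "?u k \<in> carrier R" for k using periodicD(1)[OF up] .
    let ?x = "\<lambda>k. w k \<ominus> ?u k"
    have x: "?x \<in> periodic" by (rule periodicI) (use wc uc periodicD(2)[OF w] periodicD(2)[OF up] in auto)
    have "q ?x k \<in> M" for k
    proof -
      have "(\<lambda>k. ?x k \<oplus> ?u k) = w"
      proof
        show "?x k \<oplus> ?u k = w k" for k using cancel(1) wc uc .
      qed
      then have 1: "q w k \<simeq> q ?x k \<oplus> q ?u k" using qadd[OF x up, of k] by simp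
      have "(\<lambda>k. ?v k \<oplus> ?z k) = w"
      proof
        show "?v k \<oplus> ?z k = w k" for k using cancel(2) wc periodicD(1)[OF v] .
      qed
      then have "q w k \<simeq> q ?v k \<oplus> q ?z k"
        using qadd[OF v negligibleD(1)[OF z], of k] by simp
      also have "q ?v k \<oplus> q ?z k \<simeq> q ?v k \<oplus> \<zero>"
        by (rule cong_add) (use qc[OF v] cong_refl cong_zero_iff negl[OF z] in auto)
      also have "q ?v k \<oplus> \<zero> = q ?v k" using qc[OF v] by simp
      also have "q ?v k \<simeq> ?\<nu> \<otimes> ?u k" using qact[OF multiple_one(1) w', of k] by simp
      also have "?\<nu> \<otimes> ?u k = [n] \<cdot> ?u k" using multiple_one(2)[OF uc] by simp
      also have "[n] \<cdot> ?u k \<simeq> q ?u k" using cong_sym[OF qn[OF u]] .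
      finally have 2: "q w k \<simeq> q ?u k" .
      have "q ?x k \<oplus> q ?u k \<simeq> q ?u k" using cong_trans[OF cong_sym[OF 1] 2] .
      then have "(q ?x k \<oplus> q ?u k) \<ominus> q ?u k \<in> M" by (simp add: cong_M_def)
      moreover have "(q ?x k \<oplus> q ?u k) \<ominus> q ?u k = q ?x k"
        using cancel(3) qc[OF x] qc[OF up] .
      ultimately show ?thesis by simp
    qed
    then have "?x \<in> ?X" using x by blast
    moreover have "w = (\<lambda>k. ?x k \<oplus> ?u k)"
    proof
      show "w k = ?x k \<oplus> ?u k" for k using cancel(1)[OF wc uc] by simp
    qed
    ultimately show "\<exists>x\<in>?X. \<exists>u\<in>radical_span. w = (\<lambda>k. x k \<oplus> u k)"
      using u by (intro bexI[of _ ?x] bexI[of _ ?u])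
  qed
  then have "q u k \<in> M" using radical_span_periodic[OF u] by blast
  then show ?thesis using cong_imp_mem[OF cong_sym[OF qn[OF u]]] by blast
qed

lemma multiple_component_mem:
  assumes x: "x \<in> jacobson_radical R I"
    and supp: "\<And>i. n \<le> i \<Longrightarrow> component x i = \<zero>" and j: "j < n"
  shows "[n] \<cdot> component x j \<in> M"
proof -
  have xc: "x \<in> carrier R" using jacobson_radicalD(1)[OF x] .
  have "spread x 0 (int j) = (\<Oplus>i\<in>{..<n}. if int n dvd int j - 0 - int i then component x i else \<zero>)"
    by (rule spread_eq[OF xc]) (use supp in auto)
  also have "\<dots> = (\<Oplus>i\<in>{..<n}. if j = i then component x i else \<zero>)"
  proof (rule finsum_cong')
    fix i assume "i \<in> {..<n}"
    then have "int n dvd int j - int i \<longleftrightarrow> j = i"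
      using j mod_eq_dvd_iff[of "int j" "int n" "int i"] by auto
    then show "(if int n dvd int j - 0 - int i then component x i else \<zero>) = (if j = i then component x i else \<zero>)"
      by simp
  qed (use xc in auto)
  also have "\<dots> = component x j" by (rule finsum_singleton) (use xc j in auto)
  finally show ?thesis using multiple_radical_span_mem[OF radical_span.spread[OF x], of 0 "int j"] by simp
qed

end

context graded_ring
begin

text \<open>For every period beyond the degrees of \<open>x\<close> the residue classes separate its components; two
  consecutive periods remove the factor \<open>n\<close>.\<close>

lemma component_radical_mem:
  assumes I: "graded_left_ideal R A I" and x: "x \<in> jacobson_radical R I"
  shows "component x j \<in> jacobson_radical R I"
proof -
  have xc: "x \<in> carrier R" using jacobson_radicalD(1)[OF x] .
  let ?c = "component x j"
  have cc: "?c \<in> carrier R" using xc by simp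
  obtain m where m: "\<forall>i\<in>{i. component x i \<noteq> \<zero>}. i < m"
    using component_props(2)[OF xc] finite_nat_set_iff_bounded by blast
  define n where "n = Suc (max m j)"
  have "?c \<in> M" if M: "maximal_left_ideal M R" "I \<subseteq> M" for M
  proof -
    have mult: "[l] \<cdot> ?c \<in> M" if "n \<le> l" for l
    proof -
      interpret periodic_functions R A l I M
        by (intro periodic_functions.intro periodic_functions_axioms.intro graded_ring_axioms)
          (use that I M in \<open>auto simp: n_def\<close>)
      show ?thesis by (rule multiple_component_mem[OF x]) (use that m in \<open>auto simp: n_def\<close>)
    qed
    have "[Suc n] \<cdot> ?c \<ominus> [n] \<cdot> ?c \<in> M"
      by (rule left_idealD(4)[OF maximal_left_idealD(1)[OF M(1)] mult mult]) auto
    moreover have "[Suc n] \<cdot> ?c \<ominus> [n] \<cdot> ?c = ?c"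
    proof -
      have "(y \<oplus> ?c) \<ominus> y = ?c" if "y \<in> carrier R" for y using cc that by algebra
      from this[of "[n] \<cdot> ?c"] show ?thesis using cc by simp
    qed
    ultimately show ?thesis by simp
  qed
  then show ?thesis using cc by (auto simp: jacobson_radical_def)
qed

end

theorem theorem4p11:
  fixes S :: "('a, 'b) ring_scheme"
    and A :: "nat \<Rightarrow> 'a set"
    and I :: "'a set"
  assumes "graded_ring S A"
    and "graded_left_ideal S A I"
  shows "graded_left_ideal S A (jacobson_radical S I)
    \<and> (\<forall>n\<ge>1. integral_subset S I (A n \<inter> jacobson_radical S I))"
proof -
  interpret graded_ring S A by fact
  show ?thesis
    using graded_left_idealI[OF jacobson_radical_left_ideal component_radical_mem[OF assms(2)]]
      integral_if_radical[OF assms(2)]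
    by (auto simp: integral_subset_def)
qed

end
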